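(* Let $p$ be a prime, let $a\in\mathbb{N}=\{0,1,2,\ldots\}$ and $b\in\mathbb{Z}^+=\{1,2,3,\ldots\}$. Let $f(x)\in\overline{\mathbb{Q}}_p[x]$ with $\deg f\leqslant l\in\mathbb{N}$ and $f(m)\in\overline{\mathbb{Z}}_p$ for all $m\in\mathbb{Z}$, and let $g$ be a function from $[0,p^a-1]$ to $\overline{\mathbb{Z}}_p$. For $d\in\mathbb{N}$ let $$M_d=\max\left\{\left\lfloor\frac{d-lp^a-p^{a-1}}{\varphi(p^a)}\right\rfloor,\ \operatorname{ord}_p\left(\left\lfloor\frac{d}{p^{a-1}}\right\rfloor!\right)-\operatorname{ord}_p(l!)-\min\left\{l,\left\lfloor\frac d{p^a}\right\rfloor\right\}\right\},$$ and let $d\in\mathbb{N}$ be the maximal integer with $M_d<b$. Then there exists a polynomial $$P(x)=\sum_{n=0}^d c_n\binom xn\quad (c_0,\ldots,c_d\in\overline{\mathbb{Z}}_p)$$ with $\operatorname{ord}_p(c_n)\geqslant M_n$ for all $n=0,\ldots,d$, such that $$P(p^aq+r)\equiv f(q)g(r)\pmod{p^b}\quad\text{for all } q\in\mathbb{Z}\text{ and } r\in[0,p^a-1].$$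
   Context: $\overline{\mathbb{Q}}_p$ is the algebraic closure of the $p$-adic field $\mathbb{Q}_p$ and $\overline{\mathbb{Z}}_p$ is the ring of $p$-adic algebraic integers in $\overline{\mathbb{Q}}_p$. $\operatorname{ord}_p$ denotes the $p$-adic order (valuation) on $\overline{\mathbb{Q}}_p$, normalized so that $\operatorname{ord}_p(p)=1$; for $\alpha\in\mathbb{Q}_p$, $\operatorname{ord}_p(\alpha)=\sup\{a\in\mathbb{Z}: \alpha/p^a\in\mathbb{Z}_p\}$. For $\alpha,\beta\in\overline{\mathbb{Z}}_p$, $\alpha\equiv\beta\pmod{p^b}$ means $(\alpha-\beta)/p^b\in\overline{\mathbb{Z}}_p$. For integers $m\leqslant n$, $[m,n]=\{x\in\mathbb{Z}: m\leqslant x\leqslant n\}$. $\varphi$ is Euler's totient function (so $\varphi(1)=1$), and $\lfloor\cdot\rfloor$ is the floor function; $\binom xn=x(x-1)\cdots(x-n+1)/n!$. *)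

theory Defs
  imports
    "HOL-Algebra.Algebraic_Closure_Type"
    "HOL-Number_Theory.Totient"
    "HOL-Library.Extended_Real"
    "Berlekamp_Zassenhaus.Finite_Field"
begin

hide_const (open) Polynomials.degree Polynomials.lead_coeff up_ring.coeff module.smult
  Divisibility.irreducible

text \<open>
  The prime \<open>p\<close> is carried by a type parameter, as \<open>p = CARD('p)\<close>. A \<open>p\<close>-adic integer is a
  coherent sequence of residues, i.e.\ an element of the inverse limit of the rings
  \<open>\<int>/p\<^sup>n\<int>\<close>.
\<close>

typedef ('p :: prime_card) padic_int =
  "{x :: nat \<Rightarrow> int. \<forall>n. x n \<in> {0..<int CARD('p) ^ n} \<and> x (Suc n) mod int CARD('p) ^ n = x n}"
  by (rule exI[of _ "\<lambda>_. 0"]) (auto simp: prime_gt_0_nat prime_card)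

setup_lifting type_definition_padic_int

lemma padic_residue_pos [simp]: "0 < int CARD('p :: prime_card) ^ n"
  by (simp add: prime_gt_0_nat prime_card)

lemma padic_mod_Suc:
  "(x mod int CARD('p) ^ Suc n) mod int CARD('p :: prime_card) ^ n = x mod int CARD('p) ^ n"
  by (rule mod_mod_cancel) (simp add: le_imp_power_dvd)

lemma padic_coherentI:
  assumes "\<And>n. y (Suc n) mod int CARD('p :: prime_card) ^ n = y n mod int CARD('p) ^ n"
  shows "(y n mod int CARD('p) ^ n) \<in> {0..<int CARD('p) ^ n} \<and>
    (y (Suc n) mod int CARD('p) ^ Suc n) mod int CARD('p) ^ n = y n mod int CARD('p) ^ n"
  using assms[of n] padic_mod_Suc[of "y (Suc n)" n, where 'p = 'p] by simp

instantiation padic_int :: (prime_card) comm_ring_1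
begin

lift_definition zero_padic_int :: "'a padic_int" is "\<lambda>_. 0"
  by simp

lift_definition one_padic_int :: "'a padic_int" is "\<lambda>n. 1 mod int CARD('a) ^ n"
  by (intro allI padic_coherentI) simp

lift_definition plus_padic_int :: "'a padic_int \<Rightarrow> 'a padic_int \<Rightarrow> 'a padic_int"
  is "\<lambda>x y n. (x n + y n) mod int CARD('a) ^ n"
  by (intro allI padic_coherentI) (metis mod_add_eq)

lift_definition minus_padic_int :: "'a padic_int \<Rightarrow> 'a padic_int \<Rightarrow> 'a padic_int"
  is "\<lambda>x y n. (x n - y n) mod int CARD('a) ^ n"
  by (intro allI padic_coherentI) (metis mod_diff_eq)

lift_definition uminus_padic_int :: "'a padic_int \<Rightarrow> 'a padic_int"
  is "\<lambda>x n. (- x n) mod int CARD('a) ^ n"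
  by (intro allI padic_coherentI) (metis mod_minus_eq)

lift_definition times_padic_int :: "'a padic_int \<Rightarrow> 'a padic_int \<Rightarrow> 'a padic_int"
  is "\<lambda>x y n. (x n * y n) mod int CARD('a) ^ n"
  by (intro allI padic_coherentI) (metis mod_mult_eq)

instance
proof
  show "(0 :: 'a padic_int) \<noteq> 1"
  proof (transfer, rule notI)
    assume "(\<lambda>_. 0 :: int) = (\<lambda>n. 1 mod int CARD('a) ^ n)"
    hence "0 = 1 mod int CARD('a) ^ 1"
      by (rule fun_cong)
    thus False
      using prime_gt_1_nat[OF prime_card[where 'a = 'a]] by simp
  qed
qed (transfer; auto simp: fun_eq_iff mod_simps algebra_simps)+

end

lemma Rep_padic_int_mod:
  assumes "m \<le> n"
  shows "Rep_padic_int x n mod int CARD('p) ^ m = Rep_padic_int (x :: 'p :: prime_card padic_int) m"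
  using assms
proof (induction n rule: dec_induct)
  case base
  show ?case using Rep_padic_int[of x] by simp
next
  case (step n)
  have "Rep_padic_int x (Suc n) mod int CARD('p) ^ m =
      Rep_padic_int x (Suc n) mod int CARD('p) ^ n mod int CARD('p) ^ m"
    using step.hyps by (subst mod_mod_cancel) (auto simp: le_imp_power_dvd)
  also have "Rep_padic_int x (Suc n) mod int CARD('p) ^ n = Rep_padic_int x n"
    using Rep_padic_int[of x] by simp
  finally show ?case using step.IH by simp
qed

instance padic_int :: (prime_card) idom
proof
  fix x y :: "'a padic_int"
  let ?p = "int CARD('a)"
  have prime: "prime ?p"
    using prime_card[where 'a = 'a] by simp
  have nz: "\<exists>k. Rep_padic_int z k \<noteq> 0" if "z \<noteq> 0" for z :: "'a padic_int"
    using that by (auto simp: zero_padic_int.rep_eq fun_eq_iff simp flip: Rep_padic_int_inject)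
  assume "x \<noteq> 0" "y \<noteq> 0"
  then obtain k m where km: "Rep_padic_int x k \<noteq> 0" "Rep_padic_int y m \<noteq> 0"
    using nz by blast
  define u v where "u = Rep_padic_int x (k + m)" and "v = Rep_padic_int y (k + m)"
  have ndvd: "\<not> ?p ^ k dvd u" "\<not> ?p ^ m dvd v"
    using km Rep_padic_int_mod[of k "k + m" x] Rep_padic_int_mod[of m "k + m" y]
    by (auto simp: u_def v_def dvd_eq_mod_eq_0)
  hence "u \<noteq> 0" "v \<noteq> 0" by auto
  have "multiplicity ?p u < k" "multiplicity ?p v < m"
    using ndvd by (metis multiplicity_dvd' not_le)+
  moreover have "multiplicity ?p (u * v) = multiplicity ?p u + multiplicity ?p v"
    using prime \<open>u \<noteq> 0\<close> \<open>v \<noteq> 0\<close> by (simp add: prime_elem_multiplicity_mult_distrib)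
  ultimately have "multiplicity ?p (u * v) < k + m" by simp
  hence "\<not> ?p ^ (k + m) dvd u * v"
    using prime \<open>u \<noteq> 0\<close> \<open>v \<noteq> 0\<close> by (subst power_dvd_iff_le_multiplicity) auto
  hence "Rep_padic_int (x * y) (k + m) \<noteq> 0"
    by (simp add: times_padic_int.rep_eq u_def v_def dvd_eq_mod_eq_0)
  thus "x * y \<noteq> 0"
    by (metis zero_padic_int.rep_eq)
qed

lemma Rep_padic_int_of_nat:
  "Rep_padic_int (of_nat k :: 'p :: prime_card padic_int) n = int k mod int CARD('p) ^ n"
  by (induction k)
    (simp_all add: zero_padic_int.rep_eq one_padic_int.rep_eq plus_padic_int.rep_eq mod_simps
      algebra_simps)

instance padic_int :: (prime_card) ring_char_0
proof
  have "j = k" if "of_nat j = (of_nat k :: 'a padic_int)" for j k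
  proof -
    let ?n = "j + k"
    have "int n < int CARD('a) ^ n" for n
      using of_nat_less_two_power[of n, where 'a = int] power_mono[of 2 "int CARD('a)" n]
        prime_ge_2_nat[OF prime_card[where 'a = 'a]] by linarith
    hence "int ?n < int CARD('a) ^ ?n" by blast
    hence "int j < int CARD('a) ^ ?n" "int k < int CARD('a) ^ ?n" by linarith+
    thus ?thesis
      using arg_cong[OF that, of "\<lambda>x. Rep_padic_int x ?n"]
      by (simp add: Rep_padic_int_of_nat)
  qed
  thus "inj (of_nat :: nat \<Rightarrow> 'a padic_int)"
    by (rule injI)
qed

lemma of_nat_fract: "of_nat n = to_fract (of_nat n :: 'a :: idom)"
  by (induction n) simp_all

instance fract :: ("{idom, ring_char_0}") field_char_0
  by standard (auto simp: inj_def of_nat_fract)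

type_synonym 'p padic = "'p padic_int fract"

type_synonym 'p padic_closure = "'p padic alg_closure"

definition padic_alg_ints :: "'p :: prime_card padic_closure set" where
  "padic_alg_ints = {x. \<exists>q :: 'p padic_int poly. lead_coeff q = 1 \<and>
     poly (map_poly (\<lambda>c. to_ac (to_fract c)) q) x = 0}"

text \<open>The supremum is \<open>\<infinity>\<close> for \<open>x = 0\<close>.\<close>

definition ord_padic :: "'p :: prime_card padic \<Rightarrow> ereal" where
  "ord_padic x = (SUP k \<in> {k :: int. x / of_nat CARD('p) powi k \<in> range to_fract}. ereal (of_int k))"

definition min_poly :: "'a :: field alg_closure \<Rightarrow> 'a poly" where
  "min_poly x = (THE q. lead_coeff q = 1 \<and> irreducible q \<and> poly (map_poly to_ac q) x = 0)"

lemma min_poly_ex1: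
  fixes x :: "'a :: field alg_closure"
  shows "\<exists>!q. lead_coeff q = 1 \<and> irreducible q \<and> poly (map_poly to_ac q) x = 0"
proof -
  interpret to_ac: map_poly_inj_idom_hom "to_ac :: 'a \<Rightarrow> 'a alg_closure"
    by unfold_locales auto
  define A where "A = {q :: 'a poly. q \<noteq> 0 \<and> poly (map_poly to_ac q) x = 0}"
  have "\<exists>q. q \<in> A"
    using alg_closure_algebraic[of x] unfolding A_def by blast
  then obtain m0 where m0: "m0 \<in> A" and min0: "\<And>q. q \<in> A \<Longrightarrow> degree m0 \<le> degree q"
    using exists_least_iff[of "\<lambda>n. \<exists>q. q \<in> A \<and> degree q = n"]
    by (metis not_le_imp_less)
  define m where "m = smult (inverse (lead_coeff m0)) m0"
  have m: "m \<in> A" "lead_coeff m = 1" "degree m = degree m0"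
    using m0 by (auto simp: m_def A_def map_poly_smult)
  have m_deg: "degree m > 0"
  proof (rule ccontr)
    assume "\<not> degree m > 0"
    hence "m = 1" using m(2) by (metis gr0I monic_degree_0)
    thus False using m(1) by (simp add: A_def)
  qed
  have min: "q \<in> A \<Longrightarrow> degree m \<le> degree q" for q
    using min0 m(3) by simp
  have irr: "irreducible m"
  proof (rule irreducibleI)
    show "m \<noteq> 0" using m(1) by (simp add: A_def)
    show "\<not> is_unit m" using m_deg by (auto simp: is_unit_iff_degree \<open>m \<noteq> 0\<close>)
    fix u v assume uv: "m = u * v"
    hence nz: "u \<noteq> 0" "v \<noteq> 0" using \<open>m \<noteq> 0\<close> by auto
    have "poly (map_poly to_ac u) x * poly (map_poly to_ac v) x = 0"
      using m(1) by (simp add: A_def uv hom_distribs)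
    hence "u \<in> A \<or> v \<in> A" using nz by (auto simp: A_def)
    moreover have "degree m = degree u + degree v" using nz uv by (simp add: degree_mult_eq)
    ultimately have "degree u = 0 \<or> degree v = 0" using min[of u] min[of v] by auto
    thus "is_unit u \<or> is_unit v" using nz by (auto simp: is_unit_iff_degree)
  qed
  have uniq: "q = m" if q: "lead_coeff q = 1" "irreducible q" "poly (map_poly to_ac q) x = 0" for q
  proof -
    have "map_poly to_ac q = map_poly to_ac (q div m) * map_poly to_ac m + map_poly to_ac (q mod m)"
      by (metis div_mult_mod_eq to_ac.hom_add to_ac.hom_mult)
    hence "poly (map_poly to_ac (q mod m)) x = 0"
      using q(3) m(1) by (simp add: A_def)
    hence "q mod m = 0"
      using min[of "q mod m"] degree_mod_less[of m q] m(1) m_deg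
      unfolding A_def by (metis (mono_tags, lifting) mem_Collect_eq not_less)
    then obtain k where k: "q = m * k" by (metis dvdE mod_0_imp_dvd)
    have "\<not> is_unit m" using irr by (rule irreducible_not_unit)
    hence "is_unit k" using irreducibleD[OF q(2) k] by blast
    moreover have "lead_coeff k = 1" using q(1) m(2) by (simp add: k lead_coeff_mult)
    ultimately have "k = 1"
      using monic_degree_0[of k] is_unit_iff_degree[of k] by force
    thus ?thesis by (simp add: k)
  qed
  show ?thesis
  proof (rule ex1I)
    show "lead_coeff m = 1 \<and> irreducible m \<and> poly (map_poly to_ac m) x = 0"
      using m irr unfolding A_def by blast
  qed (use uniq in blast)
qed

text \<open>
  The unique extension of the valuation is \<open>ord\<^sub>p(x) = ord\<^sub>p(N(x)) / n\<close>, where \<open>n\<close> is the degree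
  of \<open>x\<close> over \<open>\<rat>\<^sub>p\<close> and the norm \<open>N(x)\<close> from \<open>\<rat>\<^sub>p(x)\<close> to \<open>\<rat>\<^sub>p\<close> is, up to sign, the constant
  coefficient of the minimal polynomial.
\<close>

definition ord_padic_closure :: "'p :: prime_card padic_closure \<Rightarrow> ereal" where
  "ord_padic_closure x = ord_padic (coeff (min_poly x) 0) / ereal (of_nat (degree (min_poly x)))"

lemma ord_padic_closure_to_ac: "ord_padic_closure (to_ac x) = ord_padic x"
proof -
  have "min_poly (to_ac x) = [:-x, 1:]"
    unfolding min_poly_def
    by (rule the1_equality[OF min_poly_ex1])
      (auto simp: map_poly_pCons intro!: irreducible_linear_field_poly)
  moreover have "ord_padic (- x) = ord_padic x"
  proof -
    have "- y \<in> range to_fract \<longleftrightarrow> y \<in> range (to_fract :: 'a padic_int \<Rightarrow> _)" for y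
      by (metis (no_types, lifting) imageE rangeI to_fract_uminus minus_minus)
    thus ?thesis by (simp add: ord_padic_def)
  qed
  ultimately show ?thesis
    by (simp add: ord_padic_closure_def flip: one_ereal_def)
qed

lemma ord_padic_of_nat:
  assumes "n > 0"
  shows "ord_padic (of_nat n :: 'p :: prime_card padic) = ereal (of_nat (multiplicity CARD('p) n))"
proof -
  define p v where "p = CARD('p)" and "v = multiplicity p n"
  have p: "prime p" using prime_card[where 'a = 'p] by (simp add: p_def)
  obtain m where m: "n = p ^ v * m" "\<not> p dvd m"
    using multiplicity_decompose'[of n p] assms p unfolding v_def
    by (metis not_prime_unit less_numeral_extra(3))
  have [simp]: "of_nat p \<noteq> (0 :: 'p padic)" using p by auto
  have "of_nat n / of_nat p powi k \<in> range (to_fract :: 'p padic_int \<Rightarrow> _) \<longleftrightarrow> k \<le> int v" for k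
  proof
    assume "k \<le> int v"
    hence "of_nat n / of_nat p powi k = (of_nat (p ^ nat (int v - k) * m) :: 'p padic)"
      using power_int_diff[of "of_nat p :: 'p padic" "int v" k]
      prime_gt_0_nat[OF p] by (simp add: m power_int_def[of _ "int v - k"])
    thus "of_nat n / of_nat p powi k \<in> range (to_fract :: 'p padic_int \<Rightarrow> _)"
      unfolding of_nat_fract by blast
  next
    assume "of_nat n / of_nat p powi k \<in> range (to_fract :: 'p padic_int \<Rightarrow> _)"
    then obtain z where z: "of_nat n / of_nat p powi k = (to_fract z :: 'p padic)" by blast
    show "k \<le> int v"
    proof (rule ccontr)
      assume "\<not> k \<le> int v"
      define j where "j = nat (k - int v - 1)"
      have k: "k = int (v + Suc j)" using \<open>\<not> k \<le> int v\<close> by (simp add: j_def)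
      have "of_nat n = to_fract z * of_nat p ^ (v + Suc j)"
        using z prime_gt_0_nat[OF p] unfolding k power_int_of_nat
        by (subst (asm) nonzero_divide_eq_eq) simp_all
      hence "of_nat m = (to_fract z * of_nat p ^ Suc j :: 'p padic)"
        using prime_gt_0_nat[OF p] by (simp add: m power_add)
      hence "to_fract (of_nat m) = to_fract (z * of_nat (p ^ Suc j))"
        by (metis of_nat_fract of_nat_power to_fract_mult)
      hence "of_nat m = z * of_nat (p ^ Suc j)"
        by (simp only: to_fract_eq_iff)
      hence "Rep_padic_int (of_nat m :: 'p padic_int) 1 = Rep_padic_int (z * of_nat (p ^ Suc j)) 1"
        by (rule arg_cong)
      hence "int m mod int p = 0"
        unfolding times_padic_int.rep_eq Rep_padic_int_of_nat p_def [symmetric]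
        by (simp add: mod_mult_right_eq)
      thus False using m(2)
        by (metis int_dvd_int_iff mod_0_imp_dvd)
    qed
  qed
  hence *: "{k. of_nat n / of_nat p powi k \<in> range (to_fract :: 'p padic_int \<Rightarrow> _)} = {..int v}"
    by auto
  show ?thesis
    unfolding ord_padic_def p_def [symmetric] v_def [symmetric] *
    by (rule antisym) (auto intro!: SUP_least SUP_upper2[of "int v"])
qed

definition padic_cong :: "nat \<Rightarrow> 'p :: prime_card padic_closure \<Rightarrow> 'p padic_closure \<Rightarrow> bool" where
  "padic_cong b x y \<longleftrightarrow> (x - y) / of_nat CARD('p) ^ b \<in> padic_alg_ints"

definition binom_poly :: "nat \<Rightarrow> 'a :: field_char_0 poly" where
  "binom_poly n = smult (inverse (fact n)) (\<Prod>i<n. [:- of_nat i, 1:])"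

lemma poly_binom_poly: "poly (binom_poly n) x = x gchoose n"
  by (simp add: binom_poly_def gbinomial_prod_rev poly_prod field_simps atLeast0LessThan)

text \<open>
  The powers \<open>p\<^bsup>a - 1\<^esup>\<close> are taken in the reals, so that \<open>a = 0\<close> gives \<open>1/p\<close>. On positive
  integers \<open>ord\<^sub>p\<close> is the multiplicity, by \<open>ord_padic_of_nat\<close>.
\<close>

definition M_bound :: "nat \<Rightarrow> nat \<Rightarrow> nat \<Rightarrow> nat \<Rightarrow> int" where
  "M_bound p a l d = max
     \<lfloor>(real d - real l * real p ^ a - real p powi (int a - 1)) / real (totient (p ^ a))\<rfloor>
     (int (multiplicity p (fact (nat \<lfloor>real d / real p powi (int a - 1)\<rfloor>)))
       - int (multiplicity p (fact l)) - min (int l) \<lfloor>real d / real p ^ a\<rfloor>)"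

end

theory Submission
  imports Defs "Jordan_Normal_Form.Char_Poly"
begin

hide_const (open) Polynomials.degree Polynomials.lead_coeff up_ring.coeff module.smult
  Divisibility.irreducible

text \<open>
  Put \<open>q = p\<^sup>a\<close>, \<open>F(qm + r) = f(m) g(r)\<close> and let \<open>c\<^sub>n\<close> be the \<open>n\<close>-th finite difference of \<open>F\<close> at \<open>0\<close>,
  so that \<open>P\<close> is the truncated Newton series of \<open>F\<close>; once \<open>ord\<^sub>p(c\<^sub>n) \<ge> M\<^sub>n\<close> is known, the discarded
  terms vanish modulo \<open>p\<^sup>b\<close> and the congruence holds for \<open>m \<ge> 0\<close>, hence for all integers \<open>m\<close> because
  a polynomial with integral values on the naturals has integral values on the integers.

  Expanding \<open>f\<close> in binomial coefficients, \<open>c\<^sub>n\<close> is an integral combination of the integers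
  \<open>T\<^sub>j\<^sub>,\<^sub>r(n)\<close>, \<open>j \<le> l\<close>, \<open>r < q\<close>, defined by the expansion of \<open>(x - 1)\<^sup>n\<close> in powers of \<open>D = x\<^sup>q - 1\<close>,
  i.e. \<open>(x - 1)\<^sup>n = \<Sum> T\<^sub>j\<^sub>,\<^sub>r(n) x\<^sup>r D\<^sup>j\<close>. Lower bounds for \<open>ord\<^sub>p\<close> of these coefficients, weighted suitably
  in \<open>j\<close>, define ideals of \<open>\<int>[x]\<close>, and membership of \<open>(x - 1)\<^sup>n\<close> follows by induction from
  \<open>D = Y \<Phi>\<close> and the congruences \<open>(x - 1)\<^sup>s \<equiv> Y\<close>, \<open>(x - 1)\<^bsup>\<phi>(q)\<^esup> \<equiv> \<Phi>\<close>, \<open>Y\<^sup>p \<equiv> D\<close> modulo \<open>p\<close>, where \<open>s = p\<^bsup>a-1\<^esup>\<close>,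
  \<open>Y = x\<^sup>s - 1\<close> and \<open>\<Phi>\<close> is the \<open>q\<close>-th cyclotomic polynomial.
\<close>

section \<open>Expansions in powers of a cyclic polynomial\<close>

text \<open>The linear functional with \<open>x\<^sup>k \<mapsto> F k\<close>; it sends \<open>(x - 1)\<^sup>n\<close> to the \<open>n\<close>-th difference of \<open>F\<close> at \<open>0\<close>.\<close>

definition umbral :: "(nat \<Rightarrow> 'a :: comm_ring_1) \<Rightarrow> int poly \<Rightarrow> 'a" where
  "umbral F f = (\<Sum>k\<le>degree f. of_int (coeff f k) * F k)"

lemma umbral_eq_sum:
  assumes "degree f \<le> N"
  shows "umbral F f = (\<Sum>k\<le>N. of_int (coeff f k) * F k)"
  unfolding umbral_def
  by (rule sum.mono_neutral_left) (use assms in \<open>auto simp: coeff_eq_0\<close>)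

lemma umbral_add: "umbral F (f + g) = umbral F f + umbral F g"
proof -
  define N where "N = max (degree f) (degree g)"
  have "degree f \<le> N" "degree g \<le> N" "degree (f + g) \<le> N"
    by (auto simp: N_def degree_add_le)
  thus ?thesis
    by (simp add: umbral_eq_sum[of _ N] distrib_right sum.distrib)
qed

lemma umbral_smult: "umbral F (smult c f) = of_int c * umbral F f"
  by (simp add: umbral_eq_sum[of _ "degree f"] degree_smult_le sum_distrib_left mult.assoc)

lemma umbral_0 [simp]: "umbral F 0 = 0"
  by (simp add: umbral_def)

lemma umbral_sum: "umbral F (sum f A) = (\<Sum>i\<in>A. umbral F (f i))"
  by (induction A rule: infinite_finite_induct) (simp_all add: umbral_add)

lemma umbral_monom: "umbral F (monom c k) = of_int c * F k"
proof -
  have "umbral F (monom c k) = (\<Sum>i\<le>k. of_int (coeff (monom c k) i) * F i)"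
    by (rule umbral_eq_sum) (rule degree_monom_le)
  also have "\<dots> = (\<Sum>i\<le>k. if i = k then of_int c * F k else 0)"
    by (rule sum.cong) auto
  also have "\<dots> = of_int c * F k"
    by (subst sum.delta) simp_all
  finally show ?thesis .
qed

text \<open>Separates the ring-valued factors \<open>a i\<close> from the integer-valued
  \<open>\<phi> i\<close>, so that divisibility can be studied over the integers.\<close>

lemma umbral_linear_combination:
  "umbral (\<lambda>k. \<Sum>i\<in>I. a i * of_int (\<phi> i k)) f = (\<Sum>i\<in>I. a i * of_int (umbral (\<phi> i) f))"
proof -
  have "umbral (\<lambda>k. \<Sum>i\<in>I. a i * of_int (\<phi> i k)) f =
      (\<Sum>k\<le>degree f. \<Sum>i\<in>I. a i * (of_int (coeff f k) * of_int (\<phi> i k)))"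
    by (simp add: umbral_def sum_distrib_left mult.left_commute)
  also have "\<dots> = (\<Sum>i\<in>I. a i * of_int (umbral (\<phi> i) f))"
    by (subst sum.swap) (simp add: umbral_def sum_distrib_left)
  finally show ?thesis .
qed

text \<open>Apply the functional to \<open>x^m = ((x - 1) + 1)^m\<close>.\<close>

lemma umbral_newton: "F m = (\<Sum>n\<le>m. of_nat (m choose n) * umbral F ([:-1, 1:] ^ n))"
proof -
  have "monom (1 :: int) m = ([:-1, 1:] + 1) ^ m"
    by (simp add: monom_altdef one_pCons)
  also have "\<dots> = (\<Sum>n\<le>m. smult (int (m choose n)) ([:-1, 1:] ^ n))"
    by (simp add: binomial_ring of_nat_poly)
  finally have "umbral F (monom 1 m) = umbral F (\<Sum>n\<le>m. smult (int (m choose n)) ([:-1, 1:] ^ n))"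
    by simp
  thus ?thesis
    by (simp add: umbral_monom umbral_sum umbral_smult)
qed

text \<open>The coefficient of \<open>x\<^sup>r (x\<^sup>q - 1)\<^sup>j\<close> in the expansion in powers of \<open>x\<^sup>q - 1\<close>, for \<open>r < q\<close>.\<close>

definition adic_coeff :: "nat \<Rightarrow> nat \<Rightarrow> nat \<Rightarrow> int poly \<Rightarrow> int" where
  "adic_coeff q r j = umbral (\<lambda>k. if k mod q = r then int (k div q choose j) else 0)"

lemma adic_coeff_add: "adic_coeff q r j (F + G) = adic_coeff q r j F + adic_coeff q r j G"
  by (simp add: adic_coeff_def umbral_add)

lemma adic_coeff_smult: "adic_coeff q r j (smult c F) = c * adic_coeff q r j F"
  by (simp add: adic_coeff_def umbral_smult)

lemma adic_coeff_0 [simp]: "adic_coeff q r j 0 = 0"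
  by (simp add: adic_coeff_def)

lemma adic_coeff_diff: "adic_coeff q r j (F - G) = adic_coeff q r j F - adic_coeff q r j G"
  using adic_coeff_add[of q r j "F - G" G] by simp

lemma adic_coeff_monom:
  "adic_coeff q r j (monom c k) = (if k mod q = r then c * int (k div q choose j) else 0)"
  by (simp add: adic_coeff_def umbral_monom)

lemma poly_induct_monom [case_names add monom]:
  fixes F :: "'a :: comm_monoid_add poly"
  assumes add: "\<And>F G. P F \<Longrightarrow> P G \<Longrightarrow> P (F + G)" and monom: "\<And>c k. P (monom c k)"
  shows "P F"
proof -
  have "P (\<Sum>k\<le>n. monom (coeff F k) k)" for n
    by (induction n) (auto intro: add monom)
  from this[of "degree F"] show ?thesis
    by (simp only: poly_as_sum_of_monoms)
qed

text \<open>With \<open>D = x^q - 1\<close>, the product of \<open>x\<close> and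
  \<open>x^(q-1) D^j\<close> is \<open>D^(j+1) + D^j\<close>: residue \<open>q - 1\<close> wraps
  round to \<open>0\<close> and feeds two levels. On monomials this is Pascal's rule.\<close>

lemma adic_coeff_mult_X:
  assumes "r < q"
  shows "adic_coeff q r j (monom 1 1 * F) =
    (if r > 0 then adic_coeff q (r - 1) j F
     else adic_coeff q (q - 1) j F + (if j > 0 then adic_coeff q (q - 1) (j - 1) F else 0))"
proof (induction F rule: poly_induct_monom)
  case (add F G)
  thus ?case by (auto simp: distrib_left adic_coeff_add)
next
  case (monom c k)
  show ?case
    using assms by (cases j) (auto simp: mult_monom adic_coeff_monom mod_Suc div_Suc distrib_left)
qed

lemma adic_coeff_mult_cyclic:
  assumes "q > 0"
  shows "adic_coeff q r j ((monom 1 q - 1) * F) = (if j > 0 then adic_coeff q r (j - 1) F else 0)"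
proof (induction F rule: poly_induct_monom)
  case (add F G)
  thus ?case by (auto simp: distrib_left adic_coeff_add)
next
  case (monom c k)
  have "(monom 1 q - 1) * monom c k = monom c (k + q) - monom c k"
    by (simp add: left_diff_distrib mult_monom add.commute)
  thus ?case
    using assms by (cases j) (auto simp: adic_coeff_diff adic_coeff_monom algebra_simps)
qed

section \<open>Ideals cut out by conditions on the expansion coefficients\<close>

locale adic_filtration =
  fixes q :: nat and S :: "nat \<Rightarrow> int set"
  assumes q_pos: "q > 0"
    and S_0: "0 \<in> S j"
    and S_add: "x \<in> S j \<Longrightarrow> y \<in> S j \<Longrightarrow> x + y \<in> S j"
    and S_mult: "x \<in> S j \<Longrightarrow> c * x \<in> S j"
    and S_Suc: "x \<in> S j \<Longrightarrow> x \<in> S (Suc j)"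
begin

definition adic_ideal :: "int poly set" where
  "adic_ideal = {F. \<forall>r<q. \<forall>j. adic_coeff q r j F \<in> S j}"

lemma adic_ideal_add: "F \<in> adic_ideal \<Longrightarrow> G \<in> adic_ideal \<Longrightarrow> F + G \<in> adic_ideal"
  by (auto simp: adic_ideal_def adic_coeff_add S_add)

lemma adic_ideal_smult: "F \<in> adic_ideal \<Longrightarrow> smult c F \<in> adic_ideal"
  by (auto simp: adic_ideal_def adic_coeff_smult S_mult)

text \<open>The carry into residue \<open>0\<close> comes from level \<open>j - 1\<close>;
  \<open>S_Suc\<close> places it in \<open>S j\<close>.\<close>

lemma adic_ideal_mult_X:
  assumes "F \<in> adic_ideal"
  shows "monom 1 1 * F \<in> adic_ideal"
proof -
  have "adic_coeff q (q - 1) (j - 1) F \<in> S j" if "j > 0" for j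
    using that assms S_Suc[of "adic_coeff q (q - 1) (j - 1) F" "j - 1"] q_pos
    by (simp add: adic_ideal_def)
  thus ?thesis
    using assms q_pos unfolding adic_ideal_def mem_Collect_eq
    by (auto simp del: One_nat_def simp: adic_coeff_mult_X intro!: S_add)
qed

lemma adic_ideal_mult:
  assumes "F \<in> adic_ideal"
  shows "G * F \<in> adic_ideal"
proof (induction G rule: poly_induct_monom)
  case (add G H)
  thus ?case by (simp add: distrib_right adic_ideal_add)
next
  case (monom c k)
  have "monom 1 k * F \<in> adic_ideal"
  proof (induction k)
    case (Suc k)
    have "monom 1 (Suc k) * F = monom 1 1 * (monom 1 k * F)"
      by (subst mult.assoc[symmetric]) (simp add: mult_monom)
    thus ?case using adic_ideal_mult_X[OF Suc] by metis
  qed (use assms in simp)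
  moreover have "monom c k * F = smult c (monom 1 k * F)"
    by (metis mult_smult_left smult_monom mult.right_neutral)
  ultimately show ?case by (simp add: adic_ideal_smult)
qed

lemma adic_ideal_sum: "(\<And>i. i \<in> A \<Longrightarrow> F i \<in> adic_ideal) \<Longrightarrow> sum F A \<in> adic_ideal"
proof (induction A rule: infinite_finite_induct)
  case (insert i A)
  thus ?case by (simp add: adic_ideal_add)
qed (auto simp: adic_ideal_def S_0)

end

section \<open>Binomial powers and factorials modulo a prime\<close>

text \<open>The explicit factor \<open>x\<close> in the error term is what later allows
  \<open>Y\<close> to be cancelled from, or kept in, the expansion of \<open>Y ^ p\<close>.\<close>

lemma prime_power_binomial:
  fixes x y :: "'a :: comm_ring_1"
  assumes "prime p"
  shows "\<exists>w. (x + y) ^ p = x ^ p + y ^ p + of_nat p * x * w"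
proof -
  define w where "w = (\<Sum>k\<in>{1..<p}. of_nat ((p choose k) div p) * x ^ (k - 1) * y ^ (p - k))"
  have p: "p > 0" using assms prime_gt_0_nat by blast
  have "(x + y) ^ p = (\<Sum>k\<le>p. of_nat (p choose k) * x ^ k * y ^ (p - k))"
    by (rule binomial_ring)
  also have "{..p} = insert 0 (insert p {1..<p})"
    using p by auto
  also have "(\<Sum>k\<in>\<dots>. of_nat (p choose k) * x ^ k * y ^ (p - k)) =
      y ^ p + (x ^ p + (\<Sum>k\<in>{1..<p}. of_nat (p choose k) * x ^ k * y ^ (p - k)))"
    using p by simp
  also have "(\<Sum>k\<in>{1..<p}. of_nat (p choose k) * x ^ k * y ^ (p - k)) = of_nat p * x * w"
    unfolding w_def sum_distrib_left
  proof (rule sum.cong)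
    fix k assume k: "k \<in> {1..<p}"
    have "p dvd p choose k"
      using k assms by (intro dvd_choose_prime) auto
    hence "(of_nat (p choose k) :: 'a) = of_nat p * of_nat ((p choose k) div p)"
      by (metis dvd_mult_div_cancel of_nat_mult)
    moreover have "x ^ k = x * x ^ (k - 1)"
      using k by (cases k) auto
    ultimately show "of_nat (p choose k) * x ^ k * y ^ (p - k) =
        of_nat p * x * (of_nat ((p choose k) div p) * x ^ (k - 1) * y ^ (p - k))"
      by simp
  qed simp
  finally show ?thesis by (auto simp: algebra_simps)
qed

lemma prime_power_diff_one:
  fixes x :: "'a :: comm_ring_1"
  assumes "prime p"
  shows "\<exists>w. (x - 1) ^ p ^ m = x ^ p ^ m - 1 + of_nat p * w"
proof (induction m)
  case 0
  show ?case by (intro exI[of _ 0]) simp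
next
  case (Suc m)
  define z where "z = x ^ p ^ m"
  from Suc obtain w where w: "(x - 1) ^ p ^ m = (z - 1) + of_nat p * w"
    by (auto simp: z_def)
  obtain w1 where w1: "((z - 1) + of_nat p * w) ^ p =
      (z - 1) ^ p + (of_nat p * w) ^ p + of_nat p * (z - 1) * w1"
    using prime_power_binomial[OF assms] by blast
  \<comment> \<open>Expanding \<open>z ^ p\<close> about \<open>z - 1\<close>, rather than
    \<open>(z - 1) ^ p\<close> about \<open>z\<close>, avoids the sign of \<open>(-1)^p\<close>, so
    \<open>p = 2\<close> needs no separate case.\<close>
  obtain w2 where w2: "((z - 1) + 1) ^ p = (z - 1) ^ p + 1 ^ p + of_nat p * (z - 1) * w2"
    using prime_power_binomial[OF assms] by blast
  have "(of_nat p * w) ^ p = of_nat p * (w * (of_nat p * w) ^ (p - 1))"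
    using prime_gt_0_nat[OF assms] by (cases p) (auto simp: mult.assoc)
  moreover have "z ^ p - 1 = (z - 1) ^ p + of_nat p * (z - 1) * w2"
    using w2 by simp
  ultimately have "((z - 1) + of_nat p * w) ^ p = z ^ p - 1 +
      of_nat p * (w * (of_nat p * w) ^ (p - 1) + (z - 1) * w1 - (z - 1) * w2)"
    using w1 by (simp add: distrib_left right_diff_distrib left_diff_distrib mult.assoc)
  moreover have "(x - 1) ^ p ^ Suc m = ((z - 1) + of_nat p * w) ^ p"
    by (simp add: w power_mult flip: w mult.commute[of "p ^ m"])
  moreover have "x ^ p ^ Suc m = z ^ p"
    by (simp add: z_def power_mult mult.commute[of p])
  ultimately show ?case by metis
qed

text \<open>Legendre's recursion: dividing the \<open>n div p\<close> multiples of \<open>p\<close>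
  up to \<open>n\<close> by \<open>p\<close> leaves the factors of
  \<open>(n div p)!\<close>.\<close>

lemma multiplicity_fact_eq:
  assumes "prime p"
  shows "multiplicity p (fact n :: nat) = n div p + multiplicity p (fact (n div p) :: nat)"
proof (induction n)
  case (Suc n)
  have p: "p > 0" using assms prime_gt_0_nat by blast
  have *: "multiplicity p (fact (Suc k) :: nat) = multiplicity p (Suc k) + multiplicity p (fact k :: nat)" for k
    using assms unfolding fact_Suc by (subst prime_elem_multiplicity_mult_distrib) auto
  show ?case
  proof (cases "p dvd Suc n")
    case True
    then obtain k where k: "Suc n = p * k" by blast
    hence "k > 0" by (cases k) auto
    then obtain k' where k': "k = Suc k'" by (cases k) auto
    have "Suc n div p = k" using k p by simp
    moreover have "n div p = k'"
      using k k' p div_Suc[of n p] by (simp split: if_splits)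
    moreover have "multiplicity p (p * k) = Suc (multiplicity p k)"
      using assms \<open>k > 0\<close> by (subst prime_elem_multiplicity_mult_distrib) auto
    ultimately show ?thesis
      using Suc *[of n] *[of k'] by (simp add: k k')
  next
    case False
    hence "Suc n div p = n div p" by (simp add: div_Suc dvd_eq_mod_eq_0)
    moreover have "multiplicity p (Suc n) = 0" using False by (rule not_dvd_imp_multiplicity_0)
    ultimately show ?thesis using Suc *[of n] by simp
  qed
qed simp

lemma multiplicity_fact_le:
  assumes "prime p"
  shows "multiplicity p (fact n :: nat) \<le> n"
proof (induction n rule: less_induct)
  case (less n)
  have p: "p \<ge> 2" using assms prime_ge_2_nat by blast
  show ?case
  proof (cases "n = 0")
    case False
    hence "n div p < n" using p by simp
    from less[OF this] have "multiplicity p (fact n :: nat) \<le> 2 * (n div p)"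
      by (subst multiplicity_fact_eq[OF assms]) simp
    also have "\<dots> \<le> p * (n div p)" using p by simp
    also have "\<dots> \<le> n" by simp
    finally show ?thesis .
  qed simp
qed

lemma multiplicity_fact_mono:
  assumes "prime p" and "m \<le> n"
  shows "multiplicity p (fact m :: nat) \<le> multiplicity p (fact n :: nat)"
  using assms by (intro dvd_imp_multiplicity_le) (auto simp: fact_dvd)

text \<open>Compare multiplicities in \<open>s! = i! (s - i)! (s choose i)\<close>.\<close>

lemma power_multiplicity_fact_dvd_binomial:
  assumes "prime p" and "i \<le> s"
  shows "p ^ multiplicity p (fact s :: nat) dvd
    (s choose i) * p ^ multiplicity p (fact i :: nat) * p ^ multiplicity p (fact (s - i) :: nat)"
proof -
  have "multiplicity p (fact i * fact (s - i) * (s choose i)) =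
      multiplicity p (fact i :: nat) + multiplicity p (fact (s - i) :: nat) + multiplicity p (s choose i)"
    using assms by (subst prime_elem_multiplicity_mult_distrib, (auto)[3])+ simp
  hence "p ^ multiplicity p (fact s :: nat) = p ^ multiplicity p (s choose i) *
      p ^ multiplicity p (fact i :: nat) * p ^ multiplicity p (fact (s - i) :: nat)"
    using binomial_fact_lemma[OF assms(2)] by (simp add: power_add)
  thus ?thesis
    by (auto intro!: mult_dvd_mono multiplicity_dvd)
qed

section \<open>Divisibility of the expansion coefficients\<close>

text \<open>The case \<open>a = m + 1\<close>, in which \<open>p^(a-1) = p ^ m\<close> is a natural
  number; \<open>a = 0\<close> is treated separately.\<close>

locale prime_power_adic =
  fixes p m :: nat
  assumes prime_p: "prime p"
begin

definition q :: nat where "q = p ^ Suc m"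

definition \<phi> :: nat where "\<phi> = p ^ m * (p - 1)"

definition t :: "int poly" where "t = [:-1, 1:]"

definition Y :: "int poly" where "Y = [:0, 1:] ^ p ^ m - 1"

definition D :: "int poly" where "D = [:0, 1:] ^ q - 1"

definition \<Phi> :: "int poly" where "\<Phi> = (\<Sum>i<p. ([:0, 1:] ^ p ^ m) ^ i)"

lemma p_ge_2: "p \<ge> 2"
  using prime_p by (rule prime_ge_2_nat)

lemma q_pos: "q > 0"
  using p_ge_2 by (simp add: q_def)

lemma \<phi>_pos: "\<phi> > 0"
  using p_ge_2 by (simp add: \<phi>_def)

lemma q_eq: "q = p ^ m + \<phi>"
  using p_ge_2 by (simp add: q_def \<phi>_def algebra_simps)

lemma power_le_\<phi>: "p ^ m \<le> \<phi>"
  using p_ge_2 by (simp add: \<phi>_def)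

lemma t_eq: "t = [:0, 1:] - 1"
  by (simp add: t_def one_pCons)

lemma Y_nz: "Y \<noteq> 0"
proof
  assume "Y = 0"
  hence "poly Y 0 = 0" by simp
  thus False using p_ge_2 by (simp add: Y_def power_0_left)
qed

lemma D_factor: "D = Y * \<Phi>"
proof -
  have "D = ([:0, 1:] ^ p ^ m) ^ p - 1"
    by (simp only: D_def q_def power_Suc2 power_mult)
  thus ?thesis unfolding Y_def \<Phi>_def by (simp only: power_diff_1_eq)
qed

lemma ex_t_power_Y: "\<exists>w. t ^ p ^ m = Y + of_nat p * w"
  unfolding t_eq Y_def using prime_power_diff_one[OF prime_p] by blast

lemma ex_t_power_D: "\<exists>w. t ^ q = D + of_nat p * w"
  unfolding t_eq D_def q_def using prime_power_diff_one[OF prime_p] by blast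

lemma ex_Y_power: "\<exists>w. Y ^ p = D + of_nat p * Y * w"
proof -
  obtain w where "(Y + 1) ^ p = Y ^ p + 1 ^ p + of_nat p * Y * w"
    using prime_power_binomial[OF prime_p] by blast
  moreover have "(Y + 1) ^ p = D + 1"
    by (simp add: Y_def D_def q_def power_mult mult.commute[of p])
  ultimately have "Y ^ p = D + of_nat p * Y * (- w)"
    by (simp add: algebra_simps)
  thus ?thesis by blast
qed

text \<open>The error term in \<open>ex_Y_power\<close> contains \<open>Y\<close>, so cancelling
  \<open>Y\<close> makes \<open>Y ^ (p - 1)\<close> congruent to \<open>\<Phi>\<close> modulo
  \<open>p\<close>; the congruence of \<open>t ^ p ^ m\<close> with \<open>Y\<close> is then raised
  to the power \<open>p - 1\<close>.\<close>

lemma ex_t_power_\<Phi>: "\<exists>u. t ^ \<phi> = \<Phi> + of_nat p * u"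
proof -
  obtain w where w: "Y ^ p = D + of_nat p * Y * w"
    using ex_Y_power by blast
  have "Y * Y ^ (p - 1) = Y * (\<Phi> + of_nat p * w)"
    using w p_ge_2 D_factor by (cases p) (auto simp: algebra_simps)
  hence Y_pow: "Y ^ (p - 1) = \<Phi> + of_nat p * w"
    using Y_nz by (metis mult_left_cancel)
  obtain w' where w': "t ^ p ^ m = Y + of_nat p * w'"
    using ex_t_power_Y by blast
  have "t ^ p ^ m - Y dvd (t ^ p ^ m) ^ (p - 1) - Y ^ (p - 1)"
    by (simp only: power_diff_sumr2) auto
  hence "of_nat p dvd (t ^ p ^ m) ^ (p - 1) - Y ^ (p - 1)"
    using w' dvd_trans by fastforce
  then obtain v where "(t ^ p ^ m) ^ (p - 1) = Y ^ (p - 1) + of_nat p * v"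
    by (metis dvdE diff_eq_eq add.commute)
  hence "t ^ \<phi> = \<Phi> + of_nat p * (w + v)"
    unfolding \<phi>_def power_mult Y_pow by (simp only: distrib_left add.assoc)
  thus ?thesis by blast
qed

lemma adic_coeff_D:
  "adic_coeff q r j (D * F) = (if j > 0 then adic_coeff q r (j - 1) F else 0)"
proof -
  have "D = monom 1 q - 1"
    by (simp add: D_def monom_altdef)
  thus ?thesis using adic_coeff_mult_cyclic[OF q_pos] by simp
qed

lemma adic_coeff_D_power:
  "adic_coeff q r j (D ^ i * F) = (if j \<ge> i then adic_coeff q r (j - i) F else 0)"
proof (induction i arbitrary: j)
  case (Suc i)
  show ?case
    unfolding power_Suc mult.assoc adic_coeff_D Suc by auto
qed simp

section \<open>Divisibility of Fleck and Weisman type\<close>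

definition fleck_exp :: "int \<Rightarrow> nat" where
  "fleck_exp s = nat ((s - int (p ^ m)) div int \<phi>)"

text \<open>At \<open>n - j q\<close> the exponent is the first entry of \<open>M_n\<close> with
  \<open>j\<close> in place of \<open>l\<close>. The argument is an integer because
  \<open>n - j q\<close> may be negative; \<open>nat\<close> then cuts the exponent off at
  \<open>0\<close>.\<close>

definition fleck_sub :: "nat \<Rightarrow> nat \<Rightarrow> int set" where
  "fleck_sub n j = {k. int p ^ fleck_exp (int n - int j * int q) dvd k}"

lemma fleck_exp_mono: "s \<le> s' \<Longrightarrow> fleck_exp s \<le> fleck_exp s'"
  unfolding fleck_exp_def using \<phi>_pos by (intro nat_mono zdiv_mono1) auto

lemma fleck_exp_add: "fleck_exp (s + int \<phi>) \<le> Suc (fleck_exp s)"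
proof -
  have "(s + int \<phi> - int (p ^ m)) div int \<phi> = (s - int (p ^ m)) div int \<phi> + 1"
    using \<phi>_pos by (subst div_add_self2[symmetric]) (auto simp: algebra_simps)
  thus ?thesis unfolding fleck_exp_def by linarith
qed

lemma fleck_exp_eq_0: "s < int q \<Longrightarrow> fleck_exp s = 0"
proof -
  assume "s < int q"
  hence "s - int (p ^ m) < int \<phi>" unfolding q_eq by simp
  hence "(s - int (p ^ m)) div int \<phi> \<le> 0"
    using \<phi>_pos zdiv_mono1[of "s - int (p ^ m)" "int \<phi> - 1" "int \<phi>"]
    by (simp add: div_pos_pos_trivial)
  thus ?thesis by (simp add: fleck_exp_def)
qed

lemma adic_filtration_fleck: "adic_filtration q (fleck_sub n)"
proof
  fix x j assume "x \<in> fleck_sub n j"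
  moreover have "int p ^ fleck_exp (int n - int (Suc j) * int q) dvd
      int p ^ fleck_exp (int n - int j * int q)"
    by (intro le_imp_power_dvd fleck_exp_mono) (simp add: algebra_simps)
  ultimately show "x \<in> fleck_sub n (Suc j)"
    unfolding fleck_sub_def using dvd_trans by blast
qed (auto simp: fleck_sub_def q_pos)

text \<open>Plays the part of the elements of weight at least \<open>n\<close>, where
  \<open>p\<close> has weight \<open>\<phi>\<close> and \<open>D\<close> has weight
  \<open>q\<close>; see \<open>E_p\<close> and \<open>E_D\<close>.\<close>

definition E :: "nat \<Rightarrow> int poly set" where
  "E n = adic_filtration.adic_ideal q (fleck_sub n)"

lemma E_iff: "F \<in> E n \<longleftrightarrow>
    (\<forall>r<q. \<forall>j. int p ^ fleck_exp (int n - int j * int q) dvd adic_coeff q r j F)"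
  by (simp add: E_def adic_filtration.adic_ideal_def[OF adic_filtration_fleck] fleck_sub_def)

lemma E_add: "F \<in> E n \<Longrightarrow> G \<in> E n \<Longrightarrow> F + G \<in> E n"
  unfolding E_def by (rule adic_filtration.adic_ideal_add[OF adic_filtration_fleck])

lemma E_mult: "F \<in> E n \<Longrightarrow> G * F \<in> E n"
  unfolding E_def by (rule adic_filtration.adic_ideal_mult[OF adic_filtration_fleck])

lemma E_trivial: "n < q \<Longrightarrow> F \<in> E n"
proof -
  assume "n < q"
  hence "fleck_exp (int n - int j * int q) = 0" for j
    by (intro fleck_exp_eq_0) (meson diff_le_eq le_add_same_cancel1 le_less_trans of_nat_0_le_iff
        of_nat_less_iff zero_le_mult_iff)
  thus ?thesis by (simp add: E_iff)
qed

lemma E_mono: "F \<in> E n' \<Longrightarrow> n \<le> n' \<Longrightarrow> F \<in> E n"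
proof -
  assume "F \<in> E n'" "n \<le> n'"
  moreover have "int p ^ fleck_exp (int n - int j * int q) dvd
      int p ^ fleck_exp (int n' - int j * int q)" for j
    using \<open>n \<le> n'\<close> by (intro le_imp_power_dvd fleck_exp_mono) simp
  ultimately show ?thesis unfolding E_iff using dvd_trans by blast
qed

lemma E_D: "F \<in> E n \<Longrightarrow> D * F \<in> E (n + q)"
  unfolding E_iff adic_coeff_D
proof (intro allI impI)
  fix r j assume F: "\<forall>r<q. \<forall>j. int p ^ fleck_exp (int n - int j * int q) dvd adic_coeff q r j F"
    and r: "r < q"
  show "int p ^ fleck_exp (int (n + q) - int j * int q) dvd
      (if 0 < j then adic_coeff q r (j - 1) F else 0)"
  proof (cases j)
    case (Suc i)
    have "int (n + q) - int j * int q = int n - int i * int q"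
      by (simp add: Suc algebra_simps)
    moreover have "int p ^ fleck_exp (int n - int i * int q) dvd adic_coeff q r i F"
      using F r by blast
    ultimately show ?thesis by (simp only: Suc) simp
  qed simp
qed

lemma of_nat_mult_poly: "of_nat k * F = smult (int k) F"
  by (simp add: of_nat_poly)

lemma E_p: "F \<in> E n \<Longrightarrow> of_nat p * F \<in> E (n + \<phi>)"
  unfolding E_iff of_nat_mult_poly adic_coeff_smult
proof (intro allI impI)
  fix r j assume F: "\<forall>r<q. \<forall>j. int p ^ fleck_exp (int n - int j * int q) dvd adic_coeff q r j F"
    and r: "r < q"
  have "int p ^ fleck_exp (int (n + \<phi>) - int j * int q) dvd
      int p ^ Suc (fleck_exp (int n - int j * int q))"
    using fleck_exp_add[of "int n - int j * int q"]
    by (intro le_imp_power_dvd) (simp add: algebra_simps)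
  also have "\<dots> dvd int p * adic_coeff q r j F"
    using F r by simp
  finally show "int p ^ fleck_exp (int (n + \<phi>) - int j * int q) dvd int p * adic_coeff q r j F" .
qed

text \<open>The two claims are proved together since each reduces to the other at a smaller exponent.\<close>

lemma t_power_in_E_aux: "t ^ n \<in> E n \<and> \<Phi> * t ^ n \<in> E (n + \<phi>)"
proof (induction n rule: less_induct)
  case (less n)
  obtain u where u: "t ^ \<phi> = \<Phi> + of_nat p * u" using ex_t_power_\<Phi> by blast
  obtain w where w: "t ^ p ^ m = Y + of_nat p * w" using ex_t_power_Y by blast
  have "t ^ n \<in> E n"
  proof (cases "n < q")
    case False
    define k where "k = n - \<phi>"
    have n: "n = k + \<phi>" and k: "k < n"
      using False \<phi>_pos by (auto simp: k_def q_eq)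
    \<comment> \<open>Substitute for \<open>t ^ \<phi>\<close>: the summand with
      \<open>\<Phi>\<close> is the second claim at \<open>k\<close>, the other is the first claim at
      \<open>k\<close> raised by \<open>E_p\<close>.\<close>
    have "t ^ n = \<Phi> * t ^ k + of_nat p * (u * t ^ k)"
      by (simp add: n power_add u algebra_simps)
    moreover have "\<Phi> * t ^ k \<in> E n" "of_nat p * (u * t ^ k) \<in> E n"
      using less[OF k] E_p[OF E_mult] by (auto simp: n)
    ultimately show ?thesis by (simp add: E_add)
  qed (simp add: E_trivial)
  moreover have "\<Phi> * t ^ n \<in> E (n + \<phi>)"
  proof (cases "n < p ^ m")
    case False
    define k where "k = n - p ^ m"
    have "p ^ m > 0" using p_ge_2 by simp
    have n: "n = k + p ^ m" and k: "k < n"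
      using False \<open>p ^ m > 0\<close> unfolding k_def by linarith+
    \<comment> \<open>Substitute for \<open>t ^ p ^ m\<close> and use \<open>D_factor\<close>. The
      first summand is the first claim at \<open>k\<close> raised by \<open>E_D\<close>; the second
      reaches weight \<open>k + 2 \<phi>\<close>, which suffices since
      \<open>p ^ m \<le> \<phi>\<close>.\<close>
    have "\<Phi> * t ^ n = D * t ^ k + of_nat p * (w * (\<Phi> * t ^ k))"
      by (simp add: n power_add w D_factor algebra_simps)
    moreover have "D * t ^ k \<in> E (n + \<phi>)"
      using E_D[of "t ^ k" k] less[OF k] by (simp add: n q_eq add.assoc)
    moreover have "of_nat p * (w * (\<Phi> * t ^ k)) \<in> E (n + \<phi>)"
    proof (rule E_mono)
      show "of_nat p * (w * (\<Phi> * t ^ k)) \<in> E (k + \<phi> + \<phi>)"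
        by (rule E_p, rule E_mult) (use less[OF k] in blast)
    qed (use power_le_\<phi> in \<open>simp add: n\<close>)
    ultimately show ?thesis by (simp add: E_add)
  qed (simp add: E_trivial q_eq)
  ultimately show ?case by blast
qed

lemma fleck_dvd_adic_coeff:
  assumes "r < q"
  shows "int p ^ fleck_exp (int n - int j * int q) dvd adic_coeff q r j (t ^ n)"
  using t_power_in_E_aux[of n] assms by (simp add: E_iff)

section \<open>Divisibility by factorials\<close>

text \<open>
  Taken with \<open>c = 1\<close> and \<open>c = p\<close>: the factor \<open>c\<^sup>j j!\<close> turns \<open>D\<^sup>i\<close> into a multiple of \<open>c\<^sup>i i!\<close>.
\<close>

definition factorial_sub :: "int \<Rightarrow> int \<Rightarrow> nat \<Rightarrow> int set" where
  "factorial_sub c N j = {k. N dvd c ^ j * fact j * k}"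

lemma adic_filtration_factorial: "adic_filtration q (factorial_sub c N)"
proof
  fix x y j assume "x \<in> factorial_sub c N j" "y \<in> factorial_sub c N j"
  thus "x + y \<in> factorial_sub c N j" by (simp add: factorial_sub_def distrib_left)
next
  fix x j c' assume "x \<in> factorial_sub c N j"
  thus "c' * x \<in> factorial_sub c N j"
    by (simp add: factorial_sub_def mult.left_commute[of _ c'])
next
  fix x j assume "x \<in> factorial_sub c N j"
  hence "N dvd c ^ j * fact j * x" by (simp add: factorial_sub_def)
  hence "N dvd (c * int (Suc j)) * (c ^ j * fact j * x)" by (rule dvd_mult)
  thus "x \<in> factorial_sub c N (Suc j)"
    by (simp add: factorial_sub_def algebra_simps)
qed (auto simp: factorial_sub_def q_pos)

definition B :: "int \<Rightarrow> int \<Rightarrow> int poly set" where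
  "B c N = adic_filtration.adic_ideal q (factorial_sub c N)"

lemma B_iff: "F \<in> B c N \<longleftrightarrow> (\<forall>r<q. \<forall>j. N dvd c ^ j * fact j * adic_coeff q r j F)"
  by (simp add: B_def adic_filtration.adic_ideal_def[OF adic_filtration_factorial] factorial_sub_def)

lemma B_mult: "F \<in> B c N \<Longrightarrow> G * F \<in> B c N"
  unfolding B_def by (rule adic_filtration.adic_ideal_mult[OF adic_filtration_factorial])

lemma B_sum: "(\<And>i. i \<in> A \<Longrightarrow> F i \<in> B c N) \<Longrightarrow> sum F A \<in> B c N"
  unfolding B_def by (rule adic_filtration.adic_ideal_sum[OF adic_filtration_factorial])

lemma B_dvd: "F \<in> B c N \<Longrightarrow> N' dvd N \<Longrightarrow> F \<in> B c N'"
  unfolding B_iff using dvd_trans by blast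

lemma B_one: "F \<in> B c 1"
  by (simp add: B_iff)

lemma B_scale: "F \<in> B c N \<Longrightarrow> of_nat k * F \<in> B c (int k * N)"
  unfolding B_iff of_nat_mult_poly adic_coeff_smult by (simp add: mult.left_commute[of _ "int k"])

text \<open>Level \<open>j\<close> of \<open>D ^ i * F\<close> is level \<open>j - i\<close> of
  \<open>F\<close>, and \<open>j! = i! (j - i)! (j choose i)\<close> splits the weight
  accordingly.\<close>

lemma B_D_power: "F \<in> B c N \<Longrightarrow> D ^ i * F \<in> B c (c ^ i * fact i * N)"
  unfolding B_iff adic_coeff_D_power
proof (intro allI impI)
  fix r j assume F: "\<forall>r<q. \<forall>j. N dvd c ^ j * fact j * adic_coeff q r j F" and r: "r < q"
  have "c ^ i * fact i * N dvd c ^ j * fact j * adic_coeff q r (j - i) F" if "i \<le> j"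
  proof -
    have "(fact j :: int) = fact i * fact (j - i) * int (j choose i)"
      using binomial_fact_lemma[OF that] by (metis of_nat_fact of_nat_mult)
    moreover have "c ^ j = c ^ i * c ^ (j - i)"
      using that by (simp flip: power_add)
    ultimately have "c ^ j * fact j * adic_coeff q r (j - i) F =
        c ^ i * fact i * (c ^ (j - i) * fact (j - i) * adic_coeff q r (j - i) F) * int (j choose i)"
      by (simp only: mult_ac)
    moreover have "N dvd c ^ (j - i) * fact (j - i) * adic_coeff q r (j - i) F"
      using F r by blast
    ultimately show ?thesis by (metis dvd_mult2 dvd_refl mult_dvd_mono)
  qed
  thus "c ^ i * fact i * N dvd c ^ j * fact j * (if i \<le> j then adic_coeff q r (j - i) F else 0)"
    by auto
qed

definition v :: "nat \<Rightarrow> nat" where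
  "v n = multiplicity p (fact n :: nat)"

lemma power_v_dvd_fact: "int p ^ v n dvd fact n"
  unfolding v_def by (metis int_dvd_int_iff multiplicity_dvd of_nat_fact of_nat_power)

lemma power_v_dvd_binomial:
  assumes "i \<le> s"
  shows "int p ^ v s dvd int (s choose i) * int p ^ v i * int p ^ v (s - i)"
proof -
  have "p ^ v s dvd (s choose i) * p ^ v i * p ^ v (s - i)"
    unfolding v_def using prime_p assms by (rule power_multiplicity_fact_dvd_binomial)
  thus ?thesis by (metis int_dvd_int_iff of_nat_mult of_nat_power)
qed

lemma power_v_dvd_power: "int p ^ v n dvd int p ^ n"
  unfolding v_def by (intro le_imp_power_dvd multiplicity_fact_le prime_p)

text \<open>The common scheme of the three factorial estimates: \<open>M i\<close> is a divisor
  known for the \<open>i\<close>-th binomial term, and \<open>x\<close> is \<open>1\<close> or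
  \<open>Y\<close>; only numerical divisibility remains.\<close>

lemma sum_power_in_B:
  assumes "\<And>i. i \<le> s \<Longrightarrow> y ^ i * x ^ (s - i) \<in> B c (M i)"
    and "\<And>i. i \<le> s \<Longrightarrow> N dvd int (s choose i) * int p ^ (s - i) * M i"
  shows "(y + of_nat p * (x * w)) ^ s \<in> B c N"
  unfolding binomial_ring
proof (rule B_sum)
  fix i assume i: "i \<in> {..s}"
  have "of_nat (s choose i) * y ^ i * (of_nat p * (x * w)) ^ (s - i) =
      of_nat ((s choose i) * p ^ (s - i)) * (w ^ (s - i) * (y ^ i * x ^ (s - i)))"
    by (simp add: power_mult_distrib algebra_simps)
  also have "\<dots> \<in> B c (int ((s choose i) * p ^ (s - i)) * M i)"
    by (rule B_scale, rule B_mult) (use assms(1) i in simp)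
  finally show "of_nat (s choose i) * y ^ i * (of_nat p * (x * w)) ^ (s - i) \<in> B c N"
    by (rule B_dvd) (use assms(2) i in simp)
qed

text \<open>Expand \<open>t ^ q = D + p w\<close> to the power \<open>s\<close>: term
  \<open>i\<close> carries \<open>i!\<close> from \<open>D ^ i\<close> and
  \<open>p ^ (s - i)\<close>, a multiple of \<open>p ^ v (s - i)\<close>.\<close>

lemma t_power_in_B_1: "t ^ n \<in> B 1 (int p ^ v (n div q))"
proof -
  define s where "s = n div q"
  obtain w where w: "t ^ q = D + of_nat p * w" using ex_t_power_D by blast
  have "(D + of_nat p * (1 * w)) ^ s \<in> B 1 (int p ^ v s)"
  proof (rule sum_power_in_B)
    fix i assume i: "i \<le> s"
    show "D ^ i * 1 ^ (s - i) \<in> B 1 (fact i)"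
      using B_D_power[OF B_one, of i 1 1] by simp
    have "int p ^ v s dvd int (s choose i) * int p ^ v i * int p ^ v (s - i)"
      using i by (rule power_v_dvd_binomial)
    also have "\<dots> dvd int (s choose i) * fact i * int p ^ (s - i)"
      by (intro mult_dvd_mono power_v_dvd_fact power_v_dvd_power dvd_refl)
    finally show "int p ^ v s dvd int (s choose i) * int p ^ (s - i) * fact i"
      by (simp add: mult_ac)
  qed
  hence "t ^ (n mod q) * (t ^ q) ^ s \<in> B 1 (int p ^ v s)"
    by (intro B_mult) (simp add: w)
  moreover have "t ^ (n mod q) * (t ^ q) ^ s = t ^ n"
    by (simp add: s_def flip: power_mult power_add)
  ultimately show ?thesis by (simp add: s_def)
qed

text \<open>With weight \<open>c = p\<close>, \<open>D ^ i\<close> carries \<open>p ^ i\<close> and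
  \<open>i!\<close>. The error term of \<open>Y ^ p\<close> keeps a factor \<open>Y\<close>, so
  \<open>Y ^ (s - i)\<close> falls under the induction hypothesis. The total exponent
  \<open>s + v s\<close> is \<open>v n\<close> by Legendre's recursion.\<close>

lemma Y_power_in_B_p: "Y ^ n \<in> B (int p) (int p ^ v n)"
proof (induction n rule: less_induct)
  case (less n)
  define s where "s = n div p"
  have v_n: "v n = s + v s"
    unfolding v_def s_def using prime_p by (rule multiplicity_fact_eq)
  show ?case
  proof (cases "n < p")
    case True
    hence "s = 0" by (simp add: s_def)
    hence "v n = 0" by (simp add: v_n) (simp add: v_def)
    thus ?thesis using B_one by simp
  next
    case False
    hence "s < n" using p_ge_2 by (simp add: s_def)
    obtain w where w: "Y ^ p = D + of_nat p * Y * w" using ex_Y_power by blast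
    have "(D + of_nat p * (Y * w)) ^ s \<in> B (int p) (int p ^ v n)"
    proof (rule sum_power_in_B)
      fix i assume i: "i \<le> s"
      show "D ^ i * Y ^ (s - i) \<in> B (int p) (int p ^ i * fact i * int p ^ v (s - i))"
        using \<open>s < n\<close> by (intro B_D_power less) auto
      have "int p ^ v s dvd int (s choose i) * int p ^ v i * int p ^ v (s - i)"
        using i by (rule power_v_dvd_binomial)
      also have "\<dots> dvd int (s choose i) * fact i * int p ^ v (s - i)"
        by (intro mult_dvd_mono power_v_dvd_fact dvd_refl)
      finally have "int p ^ s * int p ^ v s dvd
          int p ^ s * (int (s choose i) * fact i * int p ^ v (s - i))"
        by (intro mult_dvd_mono dvd_refl)
      moreover have "int p ^ s = int p ^ (s - i) * int p ^ i"
        using i by (simp flip: power_add)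
      ultimately show "int p ^ v n dvd int (s choose i) * int p ^ (s - i) *
          (int p ^ i * fact i * int p ^ v (s - i))"
        by (simp add: v_n power_add mult_ac)
    qed
    hence "Y ^ (n mod p) * (Y ^ p) ^ s \<in> B (int p) (int p ^ v n)"
      by (intro B_mult) (simp add: w mult.assoc)
    moreover have "Y ^ (n mod p) * (Y ^ p) ^ s = Y ^ n"
      by (simp add: s_def flip: power_mult power_add)
    ultimately show ?thesis by simp
  qed
qed

lemma t_power_in_B_p: "t ^ n \<in> B (int p) (int p ^ v (n div p ^ m))"
proof -
  define s where "s = n div p ^ m"
  obtain w where w: "t ^ p ^ m = Y + of_nat p * w" using ex_t_power_Y by blast
  have "(Y + of_nat p * (1 * w)) ^ s \<in> B (int p) (int p ^ v s)"
  proof (rule sum_power_in_B)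
    fix i assume i: "i \<le> s"
    show "Y ^ i * 1 ^ (s - i) \<in> B (int p) (int p ^ v i)"
      using Y_power_in_B_p by simp
    have "int p ^ v s dvd int (s choose i) * int p ^ v i * int p ^ v (s - i)"
      using i by (rule power_v_dvd_binomial)
    also have "\<dots> dvd int (s choose i) * int p ^ v i * int p ^ (s - i)"
      by (intro mult_dvd_mono power_v_dvd_power dvd_refl)
    finally show "int p ^ v s dvd int (s choose i) * int p ^ (s - i) * int p ^ v i"
      by (simp add: mult_ac)
  qed
  hence "t ^ (n mod p ^ m) * (t ^ p ^ m) ^ s \<in> B (int p) (int p ^ v s)"
    by (intro B_mult) (simp add: w)
  moreover have "t ^ (n mod p ^ m) * (t ^ p ^ m) ^ s = t ^ n"
    by (simp add: s_def flip: power_mult power_add)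
  ultimately show ?thesis by (simp add: s_def)
qed

section \<open>The bound \<open>M_n\<close> for positive \<open>a\<close>\<close>

lemma M_bound_eq:
  "M_bound p (Suc m) l n = max ((int n - int l * int q - int (p ^ m)) div int \<phi>)
     (int (v (n div p ^ m)) - int (v l) - min (int l) (int (n div q)))"
proof -
  have "totient (p ^ Suc m) = \<phi>"
    using prime_p by (simp only: totient_prime_power_Suc \<phi>_def)
  moreover have "real n - real l * real p ^ Suc m - real p powi (int (Suc m) - 1) =
      real_of_int (int n - int l * int q - int (p ^ m))"
    by (simp add: q_def power_int_def nat_add_distrib)
  moreover have "real p powi (int (Suc m) - 1) = real (p ^ m)"
    by (simp add: power_int_def)
  moreover have "real p ^ Suc m = real q"
    by (simp add: q_def)
  moreover have "\<lfloor>real_of_int (int n - int l * int q - int (p ^ m)) / real \<phi>\<rfloor> =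
      (int n - int l * int q - int (p ^ m)) div int \<phi>"
    using floor_divide_of_int_eq[of _ "int \<phi>"] by (simp only: of_int_of_nat_eq)
  ultimately show ?thesis
    unfolding M_bound_def v_def
    by (simp only: floor_divide_of_nat_eq nat_int)
qed

text \<open>The Fleck-type bound gives the first entry of \<open>M_n\<close>. In the second entry,
  subtracting \<open>l\<close> comes from the weight \<open>c = p\<close>, and subtracting
  \<open>n div q\<close> from \<open>c = 1\<close> together with Legendre's recursion.\<close>

lemma power_M_bound_dvd_adic_coeff:
  assumes "j \<le> l" and "r < q"
  shows "int p ^ nat (M_bound p (Suc m) l n) dvd adic_coeff q r j (t ^ n)"
proof (cases "adic_coeff q r j (t ^ n) = 0")
  case False
  define T where "T = adic_coeff q r j (t ^ n)"
  define e where "e = multiplicity (int p) T"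
  have T: "T \<noteq> 0" using False by (simp add: T_def)
  have prime: "prime_elem (int p)" using prime_p by simp
  have not_unit: "\<not> is_unit (int p)" using p_ge_2 by auto
  have le_eI: "k \<le> multiplicity (int p) x" if "int p ^ k dvd x" "x \<noteq> 0" for k x
    using that not_unit by (simp add: power_dvd_iff_le_multiplicity)
  have mult_fact: "multiplicity (int p) (fact j) = v j"
  proof (rule multiplicity_eqI)
    have "\<not> p ^ Suc (v j) dvd fact j"
      using p_ge_2 by (subst power_dvd_iff_le_multiplicity) (auto simp: v_def)
    thus "\<not> int p ^ Suc (v j) dvd fact j"
      by (metis int_dvd_int_iff of_nat_fact of_nat_power)
  qed (rule power_v_dvd_fact)
  \<comment> \<open>The estimates hold at level \<open>j\<close>; replacing \<open>j\<close> by
    \<open>l\<close> only weakens them.\<close>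
  have v_mono: "v j \<le> v l"
    unfolding v_def using prime_p assms(1) by (rule multiplicity_fact_mono)
  have "fleck_exp (int n - int l * int q) \<le> fleck_exp (int n - int j * int q)"
    using assms(1) by (intro fleck_exp_mono) (simp add: mult_right_mono)
  also have "\<dots> \<le> e"
    unfolding e_def using fleck_dvd_adic_coeff[OF assms(2)] T by (intro le_eI) (auto simp: T_def)
  finally have 1: "(int n - int l * int q - int (p ^ m)) div int \<phi> \<le> int e"
    unfolding fleck_exp_def by linarith
  have "v (n div q) \<le> multiplicity (int p) (1 ^ j * fact j * T)"
    using t_power_in_B_1[of n] assms(2) T by (intro le_eI) (auto simp: B_iff T_def)
  also have "\<dots> = v j + e"
    using T prime by (simp add: prime_elem_multiplicity_mult_distrib mult_fact e_def)
  finally have 2: "v (n div q) \<le> v l + e" using v_mono by linarith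
  have "v (n div p ^ m) \<le> multiplicity (int p) (int p ^ j * fact j * T)"
    using t_power_in_B_p[of n] assms(2) T p_ge_2 by (intro le_eI) (auto simp: B_iff T_def)
  also have "\<dots> = j + v j + e"
    using T prime p_ge_2 not_unit
    by (simp add: prime_elem_multiplicity_mult_distrib mult_fact e_def multiplicity_same_power)
  finally have 3: "v (n div p ^ m) \<le> l + v l + e" using v_mono assms(1) by linarith
  have "n div p ^ m div p = n div q"
    by (simp only: q_def power_Suc2 div_mult2_eq)
  hence 4: "v (n div p ^ m) = n div q + v (n div q)"
    unfolding v_def using multiplicity_fact_eq[OF prime_p, of "n div p ^ m"] by simp
  have "nat (M_bound p (Suc m) l n) \<le> e"
    unfolding M_bound_eq using 1 2 3 4 by linarith
  hence "int p ^ nat (M_bound p (Suc m) l n) dvd T"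
    unfolding e_def by (rule multiplicity_dvd')
  thus ?thesis by (simp add: T_def)
qed simp

end

section \<open>The case \<open>a = 0\<close> and the bound for all \<open>a\<close>\<close>

lemma adic_coeff_one:
  "adic_coeff 1 0 j ([:-1, 1:] ^ n) = (if j = n then 1 else 0)"
proof -
  \<comment> \<open>For \<open>q = 1\<close> the power of \<open>x - 1\<close> is its own expansion;
    the trailing factor \<open>1\<close> lets the factors be stripped one at a time.\<close>
  have "adic_coeff 1 0 j ((monom 1 1 - 1) ^ n * 1) = (if j = n then 1 else 0)"
  proof (induction n arbitrary: j)
    case 0
    show ?case using adic_coeff_monom[of 1 0 j 1 0] by (simp add: one_pCons monom_0)
  next
    case (Suc n)
    show ?case
      unfolding power_Suc mult.assoc by (subst adic_coeff_mult_cyclic) (auto simp: Suc[simplified])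
  qed
  moreover have "monom 1 1 - 1 = [:-1, 1 :: int:]"
    by (simp add: monom_Suc one_pCons monom_0)
  ultimately show ?thesis by simp
qed

text \<open>Here \<open>p^(a-1)\<close> is \<open>1/p\<close>, which lowers the floor of an integer
  by one, and \<open>n / (1/p) = n p\<close>, whose factorial is handled by Legendre's
  recursion.\<close>

lemma M_bound_0:
  assumes "prime p"
  shows "M_bound p 0 l n = max (int n - int l - 1)
    (int n + int (multiplicity p (fact n :: nat)) - int (multiplicity p (fact l :: nat)) - min (int l) (int n))"
proof -
  have p: "p \<ge> 2" using assms prime_ge_2_nat by blast
  have "\<lfloor>real n - real l - inverse (real p)\<rfloor> = int n - int l - 1"
  proof (rule floor_unique)
    have "inverse (real p) > 0" "inverse (real p) \<le> 1"
      using p by (auto simp: inverse_le_1_iff)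
    thus "real_of_int (int n - int l - 1) \<le> real n - real l - inverse (real p)"
      "real n - real l - inverse (real p) < real_of_int (int n - int l - 1) + 1"
      by simp_all
  qed
  moreover have "nat \<lfloor>real n * real p\<rfloor> = n * p"
    by (metis floor_of_nat nat_int of_nat_mult)
  ultimately show ?thesis
    using multiplicity_fact_eq[OF assms, of "n * p"] p
    by (simp add: M_bound_def power_int_def divide_inverse)
qed

theorem power_M_bound_dvd:
  assumes "prime p" and "j \<le> l" and "r < p ^ a"
  shows "int p ^ nat (M_bound p a l n) dvd adic_coeff (p ^ a) r j ([:-1, 1:] ^ n)"
proof (cases a)
  case (Suc m)
  interpret prime_power_adic p m by standard fact
  show ?thesis
    using power_M_bound_dvd_adic_coeff[OF assms(2), of r n] assms(3)
    by (simp only: Suc q_def t_def)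
next
  case 0
  show ?thesis
  \<comment> \<open>For \<open>n \<le> l\<close> the bound is not positive; for \<open>n > l\<close>
    the coefficient itself vanishes, since \<open>j \<le> l < n\<close>.\<close>
  proof (cases "n \<le> l")
    case True
    hence "M_bound p a l n \<le> 0"
      using multiplicity_fact_mono[OF assms(1) True] by (simp add: 0 M_bound_0[OF assms(1)])
    thus ?thesis by simp
  next
    case False
    thus ?thesis using assms(2,3) adic_coeff_one[of j n] by (simp add: 0)
  qed
qed

section \<open>Integral elements over the \<open>p\<close>-adic integers\<close>

definition padic_embed :: "'p :: prime_card padic_int \<Rightarrow> 'p padic_closure" where
  "padic_embed c = to_ac (to_fract c)"

interpretation to_ac_hom: map_poly_inj_idom_hom "to_ac :: 'a :: field \<Rightarrow> 'a alg_closure"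
  by unfold_locales auto

interpretation padic_embed_hom: map_poly_inj_idom_hom
    "padic_embed :: 'p :: prime_card padic_int \<Rightarrow> 'p padic_closure"
  by unfold_locales (auto simp: padic_embed_def)

lemma padic_alg_ints_iff:
  "x \<in> padic_alg_ints \<longleftrightarrow> (\<exists>q. lead_coeff q = 1 \<and> poly (map_poly padic_embed q) x = 0)"
  by (simp add: padic_alg_ints_def padic_embed_def [abs_def])

section \<open>Module criterion for integrality\<close>

definition padic_span :: "nat \<Rightarrow> (nat \<Rightarrow> 'p :: prime_card padic_closure) \<Rightarrow> 'p padic_closure set" where
  "padic_span N v = range (\<lambda>c. \<Sum>k<N. padic_embed (c k) * v k)"

lemma padic_span_0: "0 \<in> padic_span N v"
  unfolding padic_span_def by (rule range_eqI[of _ _ "\<lambda>_. 0"]) simp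

lemma padic_span_add: "x \<in> padic_span N v \<Longrightarrow> y \<in> padic_span N v \<Longrightarrow> x + y \<in> padic_span N v"
proof -
  assume "x \<in> padic_span N v" "y \<in> padic_span N v"
  then obtain c d where "x = (\<Sum>k<N. padic_embed (c k) * v k)" "y = (\<Sum>k<N. padic_embed (d k) * v k)"
    by (auto simp: padic_span_def)
  hence "x + y = (\<Sum>k<N. padic_embed (c k + d k) * v k)"
    by (simp add: padic_embed_hom.base.hom_add distrib_right sum.distrib)
  thus ?thesis unfolding padic_span_def by (rule range_eqI[where x = "\<lambda>k. c k + d k"])
qed

lemma padic_span_scale: "x \<in> padic_span N v \<Longrightarrow> padic_embed a * x \<in> padic_span N v"
proof -
  assume "x \<in> padic_span N v"
  then obtain c where "x = (\<Sum>k<N. padic_embed (c k) * v k)"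
    by (auto simp: padic_span_def)
  hence "padic_embed a * x = (\<Sum>k<N. padic_embed (a * c k) * v k)"
    by (simp add: padic_embed_hom.base.hom_mult sum_distrib_left mult.assoc)
  thus ?thesis unfolding padic_span_def by (rule range_eqI[where x = "\<lambda>k. a * c k"])
qed

lemma padic_span_sum: "(\<And>i. i \<in> A \<Longrightarrow> f i \<in> padic_span N v) \<Longrightarrow> sum f A \<in> padic_span N v"
  by (induction A rule: infinite_finite_induct) (auto intro: padic_span_0 padic_span_add)

lemma padic_span_base: "i < N \<Longrightarrow> v i \<in> padic_span N v"
proof -
  assume "i < N"
  have "(\<Sum>k<N. padic_embed (if k = i then 1 else 0) * v k) = (\<Sum>k<N. if k = i then v i else 0)"
    by (rule sum.cong) auto
  also have "\<dots> = v i" using \<open>i < N\<close> by (subst sum.delta) auto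
  finally show ?thesis unfolding padic_span_def
    by (intro range_eqI[where x = "\<lambda>k. if k = i then 1 else 0"]) (rule sym)
qed

lemma padic_span_mult_closed:
  assumes "\<And>i. i < N \<Longrightarrow> z * v i \<in> padic_span N v" and "x \<in> padic_span N v"
  shows "z * x \<in> padic_span N v"
proof -
  obtain c where x: "x = (\<Sum>k<N. padic_embed (c k) * v k)"
    using assms(2) by (auto simp: padic_span_def)
  have "z * x = (\<Sum>k<N. padic_embed (c k) * (z * v k))"
    by (simp add: x sum_distrib_left mult.left_commute)
  thus ?thesis using assms(1) by (auto intro!: padic_span_sum padic_span_scale)
qed

text \<open>\<open>z\<close> is an eigenvalue of the matrix of multiplication by \<open>z\<close>.\<close>

lemma padic_alg_ints_if_span_stable:
  fixes z :: "'p :: prime_card padic_closure"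
  assumes stable: "\<And>i. i < N \<Longrightarrow> z * v i \<in> padic_span N v"
    and nz: "k < N" "v k \<noteq> 0"
  shows "z \<in> padic_alg_ints"
proof -
  have "\<forall>i. \<exists>c. i < N \<longrightarrow> z * v i = (\<Sum>j<N. padic_embed (c j) * v j)"
    using stable by (auto simp: padic_span_def)
  then obtain c where c: "\<And>i. i < N \<Longrightarrow> z * v i = (\<Sum>j<N. padic_embed (c i j) * v j)"
    by metis
  define A where "A = mat N N (\<lambda>(i, j). c i j)"
  define B where "B = map_mat padic_embed A"
  have A: "A \<in> carrier_mat N N" and B: "B \<in> carrier_mat N N"
    by (auto simp: A_def B_def)
  have "B *\<^sub>v vec N v = z \<cdot>\<^sub>v vec N v"
    by (rule eq_vecI) (auto simp: A_def B_def scalar_prod_def c atLeast0LessThan)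
  moreover have "vec N v \<noteq> 0\<^sub>v N"
    using nz by (metis index_vec index_zero_vec(1))
  ultimately have "eigenvector B (vec N v) z"
    using B by (simp add: eigenvector_def)
  hence "poly (char_poly B) z = 0"
    using eigenvalue_root_char_poly[OF B] by (auto simp: eigenvalue_def)
  \<comment> \<open>The characteristic polynomial is formed over the \<open>p\<close>-adic integers,
    so it is a monic equation of the required kind.\<close>
  hence "poly (map_poly padic_embed (char_poly A)) z = 0"
    using padic_embed_hom.base.char_poly_hom[OF A] by (simp add: B_def)
  moreover have "lead_coeff (char_poly A) = 1"
    using degree_monic_char_poly[OF A] by simp
  ultimately show ?thesis unfolding padic_alg_ints_iff by blast
qed

lemma monic_root_power_eq:
  assumes "lead_coeff q = 1" and "poly (map_poly padic_embed q) x = 0"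
  shows "x ^ degree q = (\<Sum>i<degree q. padic_embed (- coeff q i) * x ^ i)"
proof -
  have "0 = (\<Sum>i\<le>degree q. padic_embed (coeff q i) * x ^ i)"
    using assms(2) by (simp add: poly_altdef)
  also have "\<dots> = (\<Sum>i<degree q. padic_embed (coeff q i) * x ^ i) + x ^ degree q"
    using assms(1) by (simp add: lessThan_Suc_atMost[symmetric])
  finally show ?thesis
    by (simp add: padic_embed_hom.base.hom_uminus sum_negf eq_neg_iff_add_eq_0 add.commute)
qed

text \<open>The products \<open>x^i y^j\<close> with \<open>i < m\<close>, \<open>j < n\<close> span
  a module stable under \<open>x\<close> and \<open>y\<close>, because the monic equations rewrite
  \<open>x^m\<close> and \<open>y^n\<close> in lower powers.\<close>

lemma padic_alg_ints_add_mult: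
  assumes "x \<in> padic_alg_ints" and "y \<in> padic_alg_ints"
  shows "x + y \<in> padic_alg_ints \<and> x * y \<in> padic_alg_ints"
proof -
  obtain f where f: "lead_coeff f = 1" "poly (map_poly padic_embed f) x = 0"
    using assms(1) unfolding padic_alg_ints_iff by blast
  obtain g where g: "lead_coeff g = 1" "poly (map_poly padic_embed g) y = 0"
    using assms(2) unfolding padic_alg_ints_iff by blast
  have pos: "degree q > 0" if "lead_coeff q = 1" "poly (map_poly padic_embed q) z = 0"
    for q and z :: "'a padic_closure"
    using that monic_degree_0[of q] by (cases "degree q = 0") auto
  define m n where "m = degree f" and "n = degree g"
  have m: "m > 0" and n: "n > 0"
    using pos f g by (auto simp: m_def n_def)
  \<comment> \<open>The pair \<open>(i, j)\<close> is encoded as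
    \<open>k = i * n + j\<close>.\<close>
  define v where "v k = x ^ (k div n) * y ^ (k mod n)" for k
  let ?V = "padic_span (m * n) v"
  have V: "x ^ i * y ^ j \<in> ?V" if "i < m" "j < n" for i j
  proof -
    have "i * n + j < Suc i * n" using that by simp
    also have "\<dots> \<le> m * n" using that by (intro mult_right_mono) auto
    finally have "v (i * n + j) \<in> ?V" by (rule padic_span_base)
    thus ?thesis using that by (simp add: v_def)
  qed
  have x: "x * v k \<in> ?V" if "k < m * n" for k
  proof -
    define i j where "i = k div n" and "j = k mod n"
    have ij: "i < m" "j < n"
      using that n by (auto simp: i_def j_def less_mult_imp_div_less)
    show ?thesis
    proof (cases "Suc i < m")
      case True
      thus ?thesis using V[OF True ij(2)] by (simp add: v_def i_def j_def mult.assoc)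
    next
      case False
      hence "Suc i = m" using ij by simp
      hence "x * v k = x ^ m * y ^ j"
        by (simp add: v_def i_def j_def flip: mult.assoc power_Suc)
      also have "\<dots> = (\<Sum>i<m. padic_embed (- coeff f i) * (x ^ i * y ^ j))"
        using monic_root_power_eq[OF f] by (simp add: m_def sum_distrib_right mult.assoc)
      finally show ?thesis using V ij(2) by (auto intro!: padic_span_sum padic_span_scale)
    qed
  qed
  have y: "y * v k \<in> ?V" if "k < m * n" for k
  proof -
    define i j where "i = k div n" and "j = k mod n"
    have ij: "i < m" "j < n"
      using that n by (auto simp: i_def j_def less_mult_imp_div_less)
    show ?thesis
    proof (cases "Suc j < n")
      case True
      thus ?thesis using V[OF ij(1) True] by (simp add: v_def i_def j_def mult.left_commute)
    next
      case False
      hence "Suc j = n" using ij by simp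
      hence "y * v k = x ^ i * y ^ n"
        by (simp add: v_def i_def j_def mult.left_commute flip: power_Suc)
      also have "\<dots> = (\<Sum>j<n. padic_embed (- coeff g j) * (x ^ i * y ^ j))"
        using monic_root_power_eq[OF g] by (simp add: n_def sum_distrib_left mult.left_commute)
      finally show ?thesis using V ij(1) by (auto intro!: padic_span_sum padic_span_scale)
    qed
  qed
  have v0: "0 < m * n" "v 0 \<noteq> 0"
    using m n by (auto simp: v_def)
  show ?thesis
  proof
    show "x + y \<in> padic_alg_ints"
      using x y by (intro padic_alg_ints_if_span_stable[where N = "m * n" and v = v and k = 0] v0)
        (auto simp: distrib_right intro: padic_span_add)
    show "x * y \<in> padic_alg_ints"
      using x y by (intro padic_alg_ints_if_span_stable[where N = "m * n" and v = v and k = 0] v0)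
        (auto simp: mult.assoc intro: padic_span_mult_closed)
  qed
qed

lemma padic_alg_ints_add: "x \<in> padic_alg_ints \<Longrightarrow> y \<in> padic_alg_ints \<Longrightarrow> x + y \<in> padic_alg_ints"
  using padic_alg_ints_add_mult by blast

lemma padic_alg_ints_mult: "x \<in> padic_alg_ints \<Longrightarrow> y \<in> padic_alg_ints \<Longrightarrow> x * y \<in> padic_alg_ints"
  using padic_alg_ints_add_mult by blast

lemma padic_embed_in_padic_alg_ints: "padic_embed c \<in> padic_alg_ints"
  unfolding padic_alg_ints_iff
  by (rule exI[of _ "[:- c, 1:]"]) (simp add: padic_embed_hom.base.hom_uminus map_poly_pCons)

lemma of_int_in_padic_alg_ints: "of_int k \<in> padic_alg_ints"
  using padic_embed_in_padic_alg_ints[of "of_int k"] by (simp add: padic_embed_hom.base.hom_of_int)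

lemma padic_alg_ints_uminus: "x \<in> padic_alg_ints \<Longrightarrow> - x \<in> padic_alg_ints"
  using padic_alg_ints_mult[OF of_int_in_padic_alg_ints[of "-1"], of x] by simp

lemma padic_alg_ints_sum: "(\<And>i. i \<in> A \<Longrightarrow> f i \<in> padic_alg_ints) \<Longrightarrow> sum f A \<in> padic_alg_ints"
proof (induction A rule: infinite_finite_induct)
  case (insert i A)
  thus ?case by (simp add: padic_alg_ints_add)
qed (use of_int_in_padic_alg_ints[of 0] in simp_all)

lemma padic_alg_ints_prod_mset:
  "(\<And>x. x \<in># A \<Longrightarrow> f x \<in> padic_alg_ints) \<Longrightarrow> (\<Prod>x\<in>#A. f x) \<in> padic_alg_ints"
proof (induction A)
  case (add x A)
  thus ?case by (simp add: padic_alg_ints_mult)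
qed (use of_int_in_padic_alg_ints[of 1] in simp)

section \<open>The \<open>p\<close>-adic integers as an integrally closed valuation ring\<close>

lemma padic_int_power_dvd:
  fixes x :: "'p :: prime_card padic_int"
  assumes "Rep_padic_int x k = 0"
  shows "of_nat CARD('p) ^ k dvd x"
proof -
  let ?p = "int CARD('p)"
  \<comment> \<open>Division by \<open>p^k\<close> loses \<open>k\<close> levels of precision, so
    the quotient modulo \<open>p^n\<close> is read off from \<open>x\<close> modulo
    \<open>p^(n+k)\<close>.\<close>
  define y where "y n = Rep_padic_int x (n + k) div ?p ^ k" for n
  have "y n \<in> {0..<?p ^ n} \<and> y (Suc n) mod ?p ^ n = y n" for n
  proof
    have pw: "?p ^ k * ?p ^ n = ?p ^ (n + k)"
      by (simp add: power_add)
    define z where "z = Rep_padic_int x (n + k)"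
    have "z mod (?p ^ k * ?p ^ n) = z"
      by (simp only: z_def pw Rep_padic_int_mod[OF le_refl])
    hence "?p ^ k * (z div ?p ^ k mod ?p ^ n) + z mod ?p ^ k = ?p ^ k * (z div ?p ^ k) + z mod ?p ^ k"
      by (simp only: zmod_zmult2_eq[OF less_imp_le[OF padic_residue_pos]] mult_div_mod_eq)
    hence "?p ^ k * (z div ?p ^ k mod ?p ^ n) = ?p ^ k * (z div ?p ^ k)"
      by (simp only: add_right_cancel)
    hence "z div ?p ^ k mod ?p ^ n = z div ?p ^ k"
      using padic_residue_pos[of k, where 'p = 'p] by (metis less_irrefl mult_left_cancel)
    hence "y n = y n mod ?p ^ n"
      by (simp add: y_def z_def)
    thus "y n \<in> {0..<?p ^ n}"
      using pos_mod_bound[OF padic_residue_pos[of n, where 'p = 'p], of "y n"]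
        pos_mod_sign[OF padic_residue_pos[of n, where 'p = 'p], of "y n"] by simp
    have "Rep_padic_int x (n + k) = Rep_padic_int x (Suc n + k) mod (?p ^ k * ?p ^ n)"
      unfolding pw by (rule Rep_padic_int_mod[symmetric]) simp
    thus "y (Suc n) mod ?p ^ n = y n"
      by (simp add: y_def zmod_zmult2_eq)
  qed
  hence y: "Rep_padic_int (Abs_padic_int y :: 'p padic_int) = y"
    by (intro Abs_padic_int_inverse) auto
  have "Rep_padic_int x n =
      Rep_padic_int (of_nat (CARD('p) ^ k) * (Abs_padic_int y :: 'p padic_int)) n" for n
  proof -
    have "?p ^ k dvd Rep_padic_int x (n + k)"
      using assms Rep_padic_int_mod[of k "n + k" x] by (simp add: dvd_eq_mod_eq_0)
    hence "?p ^ k * y n = Rep_padic_int x (n + k)"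
      by (simp add: y_def)
    hence "int (CARD('p) ^ k) mod ?p ^ n * y n mod ?p ^ n = Rep_padic_int x n"
      using Rep_padic_int_mod[of n "n + k" x] by (simp add: mod_mult_left_eq)
    thus ?thesis
      by (simp only: times_padic_int.rep_eq Rep_padic_int_of_nat y)
  qed
  hence "x = of_nat (CARD('p) ^ k) * (Abs_padic_int y :: 'p padic_int)"
    by (subst Rep_padic_int_inject[symmetric]) (rule ext)
  thus ?thesis by (metis dvd_triv_left of_nat_power)
qed

text \<open>Coprimality to \<open>p\<close> gives an inverse at each level, and uniqueness of
  inverses modulo \<open>p^n\<close> makes them coherent.\<close>

lemma padic_int_unit:
  fixes x :: "'p :: prime_card padic_int"
  assumes "Rep_padic_int x 1 \<noteq> 0"
  shows "x dvd 1"
proof -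
  let ?p = "int CARD('p)"
  have prime: "prime ?p"
    using prime_card[where 'a = 'p] by simp
  have cop: "coprime (Rep_padic_int x n) (?p ^ k)" if "k \<le> n" for n k
  proof (cases "k = 0")
    case False
    hence "Rep_padic_int x n mod ?p = Rep_padic_int x 1"
      using Rep_padic_int_mod[of 1 n x] that by simp
    hence "\<not> ?p dvd Rep_padic_int x n"
      using assms by (simp add: dvd_eq_mod_eq_0)
    thus ?thesis
      using prime prime_imp_coprime[of ?p "Rep_padic_int x n"]
      by (simp add: coprime_commute)
  qed simp
  have "\<forall>n. \<exists>i. [Rep_padic_int x n * i = 1] (mod ?p ^ n)"
    using cop cong_solve_coprime_int by blast
  then obtain i where i: "\<And>n. [Rep_padic_int x n * i n = 1] (mod ?p ^ n)"
    by metis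
  define y where "y n = i n mod ?p ^ n" for n
  have "y n \<in> {0..<?p ^ n} \<and> y (Suc n) mod ?p ^ n = y n" for n
    unfolding y_def
  proof (rule padic_coherentI)
    fix n
    have "[Rep_padic_int x (Suc n) * i (Suc n) = 1] (mod ?p ^ n)"
      using i[of "Suc n"] by (rule cong_dvd_modulus) simp
    moreover have "[Rep_padic_int x (Suc n) = Rep_padic_int x n] (mod ?p ^ n)"
      using Rep_padic_int_mod[of n "Suc n" x] Rep_padic_int_mod[of n n x] by (simp add: cong_def)
    ultimately have "[Rep_padic_int x n * i (Suc n) = Rep_padic_int x n * i n] (mod ?p ^ n)"
      using i[of n] by (meson cong_scalar_right cong_sym cong_trans)
    thus "i (Suc n) mod ?p ^ n = i n mod ?p ^ n"
      using cong_mult_lcancel[OF cop[OF le_refl, of n]] unfolding cong_def by blast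
  qed
  hence y: "Rep_padic_int (Abs_padic_int y :: 'p padic_int) = y"
    by (intro Abs_padic_int_inverse) auto
  have "Rep_padic_int (x * Abs_padic_int y) n = Rep_padic_int (1 :: 'p padic_int) n" for n
    using i[of n]
    by (simp add: times_padic_int.rep_eq one_padic_int.rep_eq y y_def mod_mult_right_eq cong_def)
  hence "x * Abs_padic_int y = 1"
    by (subst Rep_padic_int_inject[symmetric]) (rule ext)
  thus ?thesis by (metis dvd_triv_left)
qed

lemma padic_int_decompose:
  fixes x :: "'p :: prime_card padic_int"
  assumes "x \<noteq> 0"
  shows "\<exists>k u. x = of_nat CARD('p) ^ k * u \<and> u dvd 1"
proof -
  have "\<exists>n. Rep_padic_int x n \<noteq> 0"
    using assms by (auto simp: zero_padic_int.rep_eq fun_eq_iff simp flip: Rep_padic_int_inject)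
  \<comment> \<open>Level \<open>0\<close> is a residue modulo \<open>1\<close>, so the least
    nonzero level has a predecessor, which serves as \<open>k\<close>.\<close>
  moreover have "Rep_padic_int x 0 = 0"
    using Rep_padic_int_mod[of 0 0 x] by simp
  ultimately obtain k where k: "Rep_padic_int x k = 0" "Rep_padic_int x (Suc k) \<noteq> 0"
    using exists_least_iff[of "\<lambda>n. Rep_padic_int x n \<noteq> 0"] not0_implies_Suc lessI by metis
  obtain u where u: "x = of_nat CARD('p) ^ k * u"
    using padic_int_power_dvd[OF k(1)] by blast
  have "Rep_padic_int u 1 \<noteq> 0"
  proof
    assume "Rep_padic_int u 1 = 0"
    then obtain w where "u = of_nat CARD('p) * w"
      using padic_int_power_dvd[of u 1] by auto
    hence "x = of_nat (CARD('p) ^ Suc k) * w"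
      by (simp add: u mult_ac)
    hence "Rep_padic_int x (Suc k) = 0"
      by (simp only: times_padic_int.rep_eq Rep_padic_int_of_nat) simp
    thus False using k by simp
  qed
  thus ?thesis using u padic_int_unit by blast
qed

lemma padic_int_dvd_total: "x dvd y \<or> y dvd x" for x y :: "'p :: prime_card padic_int"
proof (cases "x = 0 \<or> y = 0")
  case False
  then obtain k u j w where x: "x = of_nat CARD('p) ^ k * u" "u dvd 1"
    and y: "y = of_nat CARD('p) ^ j * w" "w dvd 1"
    using padic_int_decompose by metis
  show ?thesis
  proof (cases "k \<le> j")
    case True
    have "x dvd y"
      unfolding x y using True x(2) by (intro mult_dvd_mono le_imp_power_dvd) (auto dest: dvd_trans)
    thus ?thesis ..
  next
    case False
    hence "y dvd x"
      unfolding x y using y(2) by (intro mult_dvd_mono le_imp_power_dvd) (auto dest: dvd_trans)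
    thus ?thesis ..
  qed
qed auto

text \<open>If \<open>b\<close> does not divide \<open>a\<close>, then \<open>u = 1/y\<close> is a
  \<open>p\<close>-adic integer. Multiplying a monic equation for \<open>y\<close> of degree
  \<open>n\<close> by \<open>u^n\<close> equates \<open>1\<close> with a multiple of
  \<open>u\<close>, so \<open>u\<close> is a unit.\<close>

lemma padic_int_integrally_closed:
  fixes y :: "'p :: prime_card padic"
  assumes "to_ac y \<in> padic_alg_ints"
  shows "y \<in> range to_fract"
proof -
  obtain a b where ab: "y = to_fract a / to_fract b" "b \<noteq> 0"
    by (metis Fract_conv_to_fract Fract_cases)
  show ?thesis
  proof (cases "b dvd a")
    case True
    then obtain c where "a = b * c" by blast
    thus ?thesis using ab by simp
  next
    case False
    then obtain u where u: "b = a * u" using padic_int_dvd_total by blast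
    with ab have nz: "a \<noteq> 0" "u \<noteq> 0" by auto
    have yu: "y * to_fract u = 1" using ab u nz by simp
    obtain q where q: "lead_coeff q = 1" "poly (map_poly padic_embed q) (to_ac y) = 0"
      using assms unfolding padic_alg_ints_iff by blast
    define n where "n = degree q"
    have yu': "to_ac y * padic_embed u = 1"
      using yu by (metis padic_embed_def to_ac_1 to_ac_mult)
    have "n > 0"
      using q monic_degree_0[of q] by (cases "degree q = 0") (auto simp: n_def)
    have "1 = (to_ac y * padic_embed u) ^ n" by (simp add: yu')
    also have "\<dots> = (\<Sum>i<n. padic_embed (- coeff q i) * (to_ac y ^ i * padic_embed u ^ n))"
      using monic_root_power_eq[OF q]
      by (simp add: n_def power_mult_distrib sum_distrib_right mult.assoc)
    also have "\<dots> = (\<Sum>i<n. padic_embed (- coeff q i * u ^ (n - i)))"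
    proof (rule sum.cong)
      fix i assume "i \<in> {..<n}"
      hence "to_ac y ^ i * padic_embed u ^ n = (to_ac y * padic_embed u) ^ i * padic_embed u ^ (n - i)"
        by (simp add: power_mult_distrib mult.assoc flip: power_add)
      thus "padic_embed (- coeff q i) * (to_ac y ^ i * padic_embed u ^ n) =
          padic_embed (- coeff q i * u ^ (n - i))"
        by (simp only: yu' padic_embed_hom.base.hom_mult padic_embed_hom.base.hom_power) simp
    qed simp
    also have "\<dots> = padic_embed (\<Sum>i<n. - coeff q i * u ^ (n - i))"
      by (simp only: padic_embed_hom.base.hom_sum)
    finally have "padic_embed 1 = padic_embed (\<Sum>i<n. - coeff q i * u ^ (n - i))"
      by simp
    hence "1 = (\<Sum>i<n. - coeff q i * u ^ (n - i))"
      by (rule padic_embed_hom.base.injectivity)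
    moreover have "u dvd (\<Sum>i<n. - coeff q i * u ^ (n - i))"
      by (intro dvd_sum dvd_mult dvd_power) auto
    ultimately have "u dvd 1" by simp
    then obtain w where "1 = u * w" by blast
    hence "to_fract u * to_fract w = 1"
      by (metis to_fract_1 to_fract_mult)
    hence "y = y * (to_fract u * to_fract w)"
      by simp
    hence "y = to_fract w"
      by (simp only: yu mult.assoc[symmetric] mult_1)
    thus ?thesis by blast
  qed
qed

section \<open>Minimal polynomials and the order\<close>

lemma min_poly_props:
  fixes x :: "'a :: field alg_closure"
  shows "lead_coeff (min_poly x) = 1" "irreducible (min_poly x)"
    "poly (map_poly to_ac (min_poly x)) x = 0"
  using theI'[OF min_poly_ex1[of x]] by (simp_all add: min_poly_def)

text \<open>\<open>min_poly\<close> is given by irreducibility, whereas division with remainder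
  calls for an annihilator \<open>m\<close> of least degree; irreducibility makes the two
  associates.\<close>

lemma min_poly_dvd:
  fixes x :: "'a :: field alg_closure"
  assumes "poly (map_poly to_ac q) x = 0"
  shows "min_poly x dvd q"
proof -
  define A where "A = {f :: 'a poly. f \<noteq> 0 \<and> poly (map_poly to_ac f) x = 0}"
  have min_A: "min_poly x \<in> A"
    using min_poly_props[of x] by (auto simp: A_def)
  then obtain m where m: "m \<in> A" and min: "\<And>f. f \<in> A \<Longrightarrow> degree m \<le> degree f"
    using exists_least_iff[of "\<lambda>n. \<exists>f. f \<in> A \<and> degree f = n"] by (metis not_le_imp_less)
  have dvd: "m dvd f" if "poly (map_poly to_ac f) x = 0" for f
  proof -
    have "map_poly to_ac f = map_poly to_ac (f div m) * map_poly to_ac m + map_poly to_ac (f mod m)"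
      by (metis div_mult_mod_eq to_ac_hom.hom_add to_ac_hom.hom_mult)
    hence "poly (map_poly to_ac (f mod m)) x = 0"
      using that m by (simp add: A_def)
    hence "f mod m = 0"
      using min[of "f mod m"] degree_mod_less[of m f] m by (fastforce simp: A_def)
    thus ?thesis by (rule mod_0_imp_dvd)
  qed
  obtain k where k: "min_poly x = m * k"
    using dvd[OF min_poly_props(3)] by blast
  have "\<not> is_unit m"
  proof
    assume "is_unit m"
    hence "degree m = 0" using is_unit_iff_degree m by (auto simp: A_def)
    then obtain c where "m = [:c:]" by (rule degree_eq_zeroE)
    thus False using m by (auto simp: A_def)
  qed
  hence "is_unit k"
    using irreducibleD[OF min_poly_props(2) k] by blast
  hence "min_poly x dvd m"
    by (simp add: k mult_unit_dvd_iff)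
  thus ?thesis using dvd[OF assms] dvd_trans by blast
qed

lemma ord_padic_ge:
  fixes x :: "'p :: prime_card padic"
  assumes "x / of_nat CARD('p) ^ k \<in> range to_fract"
  shows "ord_padic x \<ge> ereal (of_nat k)"
  unfolding ord_padic_def using assms by (intro SUP_upper2[of "int k"]) auto

text \<open>
  The constant coefficient of the minimal polynomial is, up to sign, the product of the conjugates
  of \<open>x\<close>, each of which is \<open>p\<^sup>k\<close> times an integral element.
\<close>

lemma ord_padic_closure_ge:
  fixes x :: "'p :: prime_card padic_closure"
  assumes "x / of_nat CARD('p) ^ k \<in> padic_alg_ints"
  shows "ord_padic_closure x \<ge> ereal (of_nat k)"
proof -
  define \<pi> where "\<pi> = (of_nat CARD('p) ^ k :: 'p padic)"
  define \<mu> where "\<mu> = min_poly x"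
  define n where "n = degree \<mu>"
  have \<pi>: "to_ac \<pi> = of_nat CARD('p) ^ k" "\<pi> \<noteq> 0"
    by (simp_all add: \<pi>_def to_ac_hom.base.hom_power)
  obtain q where q: "lead_coeff q = 1" "poly (map_poly padic_embed q) (x / to_ac \<pi>) = 0"
    using assms unfolding padic_alg_ints_iff \<pi> by blast
  \<comment> \<open>\<open>Q(z) = q(z / \<pi>)\<close>, so each root of \<open>\<mu>\<close>, being
    a root of \<open>Q\<close>, is \<open>\<pi>\<close> times an integral element.\<close>
  define Q where "Q = pcompose (map_poly to_fract q) [:0, inverse \<pi>:]"
  have Q: "poly (map_poly to_ac Q) z = poly (map_poly padic_embed q) (z / to_ac \<pi>)" for z
    unfolding Q_def padic_embed_def [abs_def]
    by (simp add: to_ac_hom.base.map_poly_pcompose poly_pcompose to_ac_hom.base.map_poly_pCons_hom map_poly_map_poly o_def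
        divide_inverse to_ac_inverse)
  have "\<mu> dvd Q"
    unfolding \<mu>_def using q Q by (intro min_poly_dvd) simp
  have \<mu>: "lead_coeff \<mu> = 1" "irreducible \<mu>" "poly (map_poly to_ac \<mu>) x = 0"
    using min_poly_props[of x] by (simp_all add: \<mu>_def)
  have "n > 0"
    using \<mu>(1,2) monic_degree_0[of \<mu>] by (cases "degree \<mu> = 0") (auto simp: n_def)
  have "map_poly to_ac \<mu> \<noteq> 0" using \<mu> by auto
  from alg_closed_imp_factorization[OF this] obtain A where A: "size A = n"
    "map_poly to_ac \<mu> = (\<Prod>\<rho>\<in>#A. [:- \<rho>, 1:])"
    using \<mu>(1) by (auto simp: n_def)
  have int: "- (\<rho> / to_ac \<pi>) \<in> padic_alg_ints" if "\<rho> \<in># A" for \<rho>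
  proof -
    have "poly (map_poly to_ac \<mu>) \<rho> = 0"
      using that by (auto simp: A(2) poly_prod_mset)
    hence "poly (map_poly to_ac Q) \<rho> = 0"
      using \<open>\<mu> dvd Q\<close> by (auto elim!: dvdE simp: to_ac_hom.hom_mult)
    hence "\<rho> / to_ac \<pi> \<in> padic_alg_ints"
      using Q q(1) unfolding padic_alg_ints_iff by auto
    thus ?thesis by (rule padic_alg_ints_uminus)
  qed
  have "to_ac (coeff \<mu> 0) = poly (map_poly to_ac \<mu>) 0"
    by (simp add: poly_0_coeff_0)
  also have "\<dots> = (\<Prod>\<rho>\<in>#A. - \<rho>)"
    by (simp add: A(2) poly_prod_mset)
  also have "\<dots> = (\<Prod>\<rho>\<in>#A. to_ac \<pi> * - (\<rho> / to_ac \<pi>))"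
    using \<pi>(2) by simp
  also have "\<dots> = to_ac \<pi> ^ n * (\<Prod>\<rho>\<in>#A. - (\<rho> / to_ac \<pi>))"
    by (simp only: prod_mset.distrib prod_mset_constant A(1))
  \<comment> \<open>This quotient is integral and lies in the base field, hence is a
    \<open>p\<close>-adic integer: the constant coefficient has order at least \<open>k * n\<close>,
    and dividing by the degree \<open>n\<close> leaves \<open>k\<close>.\<close>
  finally have "to_ac (coeff \<mu> 0 / \<pi> ^ n) = (\<Prod>\<rho>\<in>#A. - (\<rho> / to_ac \<pi>))"
    using \<pi>(2) by (simp add: to_ac_divide to_ac_hom.base.hom_power)
  also have "\<dots> \<in> padic_alg_ints"
    using int by (rule padic_alg_ints_prod_mset)
  finally have "coeff \<mu> 0 / \<pi> ^ n \<in> range to_fract"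
    by (rule padic_int_integrally_closed)
  hence "ord_padic (coeff \<mu> 0) \<ge> ereal (of_nat (k * n))"
    by (intro ord_padic_ge) (simp add: \<pi>_def power_mult)
  hence "ord_padic (coeff \<mu> 0) / ereal (of_nat n) \<ge> ereal (of_nat (k * n)) / ereal (of_nat n)"
    using \<open>n > 0\<close> by (intro ereal_divide_right_mono) auto
  thus ?thesis
    using \<open>n > 0\<close> by (simp add: ord_padic_closure_def \<mu>_def n_def)
qed

section \<open>Newton series\<close>

lemma umbral_in_padic_alg_ints:
  "(\<And>k. F k \<in> padic_alg_ints) \<Longrightarrow> umbral F f \<in> padic_alg_ints"
  unfolding umbral_def
  by (intro padic_alg_ints_sum padic_alg_ints_mult of_int_in_padic_alg_ints)

lemma degree_binom_poly_le: "degree (binom_poly n :: 'a :: field_char_0 poly) \<le> n"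
proof -
  have "degree (\<Prod>i<n. [:- of_nat i, 1 :: 'a:]) \<le> (\<Sum>i<n. degree [:- of_nat i, 1 :: 'a:])"
    using degree_prod_sum_le[of "{..<n}" "\<lambda>i. [:- of_nat i, 1 :: 'a:]"] by (simp add: o_def)
  thus ?thesis by (simp add: binom_poly_def)
qed

text \<open>Both sides have degree at most \<open>l\<close> and agree at \<open>0, ..., l\<close> by
  \<open>umbral_newton\<close>, as the terms with \<open>j > m\<close> vanish at
  \<open>m\<close>.\<close>

lemma poly_newton:
  fixes f :: "'a :: field_char_0 poly"
  assumes "degree f \<le> l"
  shows "poly f x = (\<Sum>j\<le>l. umbral (\<lambda>k. poly f (of_nat k)) ([:-1, 1:] ^ j) * (x gchoose j))"
proof -
  define e where "e j = umbral (\<lambda>k. poly f (of_nat k)) ([:-1, 1:] ^ j)" for j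
  define h where "h = (\<Sum>j\<le>l. smult (e j) (binom_poly j))"
  have deg: "degree h \<le> l"
    unfolding h_def
    by (rule degree_sum_le) (auto intro: order_trans[OF degree_smult_le] order_trans[OF degree_binom_poly_le])
  have h: "poly h x = (\<Sum>j\<le>l. e j * (x gchoose j))" for x
    by (simp add: h_def poly_sum poly_binom_poly)
  have "f = h"
  proof (rule poly_eqI_degree)
    fix x :: 'a assume "x \<in> of_nat ` {..l}"
    then obtain m where m: "x = of_nat m" "m \<le> l" by auto
    have "poly h x = (\<Sum>j\<le>l. of_nat (m choose j) * e j)"
      by (simp add: h m(1) binomial_gbinomial mult.commute)
    also have "\<dots> = (\<Sum>j\<le>m. of_nat (m choose j) * e j)"
      by (rule sum.mono_neutral_right) (use m(2) in auto)
    also have "\<dots> = poly f x"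
      unfolding m(1) e_def by (rule umbral_newton[of "\<lambda>k. poly f (of_nat k)", symmetric])
    finally show "poly f x = poly h x" ..
  next
    have "card (of_nat ` {..l} :: 'a set) = Suc l"
      by (subst card_image) (auto intro: inj_onI)
    thus "degree f < card (of_nat ` {..l} :: 'a set)" "degree h < card (of_nat ` {..l} :: 'a set)"
      using assms deg by auto
  qed
  thus ?thesis using h[of x] by (simp add: e_def)
qed

lemma of_int_gbinomial_in_Ints: "(of_int m gchoose n :: 'a :: field_char_0) \<in> \<int>"
proof (cases "m \<ge> 0")
  case True
  then obtain k where "m = int k" by (metis nonneg_int_cases)
  thus ?thesis by (simp flip: binomial_gbinomial)
next
  case False
  define k where "k = nat (int n - m - 1)"
  have "int k = int n - m - 1" using False by (simp add: k_def)
  hence "of_nat n - of_int m - 1 = (of_nat k :: 'a)"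
    by (metis of_int_1 of_int_diff of_int_of_nat_eq)
  hence "(of_int m gchoose n :: 'a) = (- 1) ^ n * of_nat (k choose n)"
    by (subst gbinomial_negated_upper) (simp add: binomial_gbinomial)
  thus ?thesis by simp
qed

text \<open>The Newton coefficients involve values at naturals only, and binomial coefficients are
  integers at negative arguments too.\<close>

lemma poly_of_int_in_padic_alg_ints:
  assumes "\<And>k :: nat. poly f (of_nat k) \<in> padic_alg_ints"
  shows "poly f (of_int m) \<in> padic_alg_ints"
proof -
  have "(of_int m gchoose j :: 'a padic_closure) \<in> padic_alg_ints" for j
    using of_int_gbinomial_in_Ints[of m j] of_int_in_padic_alg_ints by (metis Ints_cases)
  thus ?thesis
    using assms by (subst poly_newton[OF order_refl])
      (intro padic_alg_ints_sum padic_alg_ints_mult umbral_in_padic_alg_ints)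
qed

section \<open>The truncated Newton series\<close>

theorem theorem1p1:
  fixes p a b l d :: nat
    and f :: "'p :: prime_card padic_closure poly"
    and g :: "int \<Rightarrow> 'p padic_closure"
  assumes "p = CARD('p)"
    and "b > 0"
    and "degree f \<le> l"
    and "\<forall>m :: int. poly f (of_int m) \<in> padic_alg_ints"
    and "\<forall>r \<in> {0..int p ^ a - 1}. g r \<in> padic_alg_ints"
    and "M_bound p a l d < int b"
    and "\<forall>d'. M_bound p a l d' < int b \<longrightarrow> d' \<le> d"
  shows "\<exists>(P :: 'p padic_closure poly) c.
    P = (\<Sum>n = 0..d. smult (c n) (binom_poly n)) \<and>
    (\<forall>n \<in> {0..d}. c n \<in> padic_alg_ints \<and>
       ord_padic_closure (c n) \<ge> ereal (of_int (M_bound p a l n))) \<and>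
    (\<forall>q :: int. \<forall>r \<in> {0..int p ^ a - 1}.
       padic_cong b (poly P (of_int (int p ^ a * q + r))) (poly f (of_int q) * g r))"
proof -
  define q where "q = p ^ a"
  define F where "F k = poly f (of_nat (k div q)) * g (int (k mod q))" for k
  define c where "c n = umbral F ([:-1, 1:] ^ n)" for n
  define e where "e j = umbral (\<lambda>k. poly f (of_nat k)) ([:-1, 1:] ^ j)" for j
  define P where "P = (\<Sum>n = 0..d. smult (c n) (binom_poly n))"
  define \<pi> where "\<pi> = (of_nat p :: 'p padic_closure)"
  have p: "prime p" using prime_card[where 'a = 'p] assms(1) by simp
  have \<pi>: "\<pi> \<noteq> 0" using p by (simp add: \<pi>_def prime_gt_0_nat)
  have q: "q > 0" using p by (simp add: q_def prime_gt_0_nat)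
  have f_int: "poly f (of_nat k) \<in> padic_alg_ints" for k
    using assms(4)[rule_format, of "int k"] by simp
  have g_int: "g (int r) \<in> padic_alg_ints" if "r < q" for r
  proof -
    have "int r < int p ^ a" using that unfolding q_def by (metis of_nat_less_iff of_nat_power)
    thus ?thesis using assms(5) by simp
  qed
  have e_int: "e j \<in> padic_alg_ints" for j
    unfolding e_def using f_int by (rule umbral_in_padic_alg_ints)
  have c_int: "c n \<in> padic_alg_ints" for n
    unfolding c_def F_def using f_int g_int q
    by (intro umbral_in_padic_alg_ints padic_alg_ints_mult) auto
  \<comment> \<open>Expanding \<open>f\<close> in binomial coefficients and \<open>g\<close> in
    indicators of residue classes writes \<open>F\<close> in terms of the functions that define
    \<open>adic_coeff\<close>.\<close>
  have F_eq: "F = (\<lambda>k. \<Sum>(j, r)\<in>{..l} \<times> {..<q}.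
      (e j * g (int r)) * of_int (if k mod q = r then int (k div q choose j) else 0))"
  proof
    fix k
    have "(\<Sum>(j, r)\<in>{..l} \<times> {..<q}.
        (e j * g (int r)) * of_int (if k mod q = r then int (k div q choose j) else 0)) =
        (\<Sum>j\<le>l. \<Sum>r<q. if r = k mod q
           then (e j * g (int (k mod q))) * of_nat (k div q choose j) else 0)"
      unfolding sum.cartesian_product[symmetric] by (intro sum.cong refl) auto
    also have "\<dots> = (\<Sum>j\<le>l. (e j * g (int (k mod q))) * of_nat (k div q choose j))"
      using q by (subst sum.delta) auto
    also have "\<dots> = (\<Sum>j\<le>l. e j * (of_nat (k div q) gchoose j)) * g (int (k mod q))"
      by (simp add: sum_distrib_right sum_distrib_left binomial_gbinomial mult_ac)
    also have "\<dots> = F k"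
      using poly_newton[OF assms(3), of "of_nat (k div q)"] by (simp only: F_def e_def)
    finally show "F k = (\<Sum>(j, r)\<in>{..l} \<times> {..<q}.
      (e j * g (int r)) * of_int (if k mod q = r then int (k div q choose j) else 0))" ..
  qed
  have c_eq: "c n = (\<Sum>(j, r)\<in>{..l} \<times> {..<q}.
      (e j * g (int r)) * of_int (adic_coeff q r j ([:-1, 1:] ^ n)))" for n
    unfolding c_def F_eq adic_coeff_def case_prod_unfold by (rule umbral_linear_combination)
  have c_div: "c n / \<pi> ^ nat (M_bound p a l n) \<in> padic_alg_ints" for n
  proof -
    have "(e j * g (int r)) * of_int (adic_coeff q r j ([:-1, 1:] ^ n)) / \<pi> ^ nat (M_bound p a l n)
        \<in> padic_alg_ints" if jr: "j \<le> l" "r < q" for j r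
    proof -
      obtain T where "adic_coeff q r j ([:-1, 1:] ^ n) = int p ^ nat (M_bound p a l n) * T"
        using power_M_bound_dvd[OF p jr(1), of r a n] jr(2) unfolding q_def by blast
      hence "(e j * g (int r)) * of_int (adic_coeff q r j ([:-1, 1:] ^ n)) /
          \<pi> ^ nat (M_bound p a l n) = (e j * g (int r)) * of_int T"
        using \<pi> by (simp add: \<pi>_def)
      thus ?thesis
        using jr by (simp add: padic_alg_ints_mult e_int g_int of_int_in_padic_alg_ints)
    qed
    thus ?thesis
      unfolding c_eq sum_divide_distrib by (intro padic_alg_ints_sum) auto
  qed
  have ord: "ord_padic_closure (c n) \<ge> ereal (of_int (M_bound p a l n))" for n
  proof -
    \<comment> \<open>\<open>nat\<close> replaces a negative bound by \<open>0\<close>, which only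
      strengthens the claim.\<close>
    have "ereal (of_int (M_bound p a l n)) \<le> ereal (of_nat (nat (M_bound p a l n)))"
      by simp
    also have "\<dots> \<le> ord_padic_closure (c n)"
      using c_div[of n] unfolding \<pi>_def assms(1) by (rule ord_padic_closure_ge)
    finally show ?thesis .
  qed
  have c_large: "c n / \<pi> ^ b \<in> padic_alg_ints" if "n > d" for n
  proof -
    define K where "K = nat (M_bound p a l n)"
    \<comment> \<open>Maximality of \<open>d\<close> excludes \<open>M_n < b\<close> for each single
      \<open>n > d\<close>; no monotonicity in \<open>n\<close> enters.\<close>
    have "\<not> M_bound p a l n < int b" using assms(7) that by (metis not_le)
    hence "b \<le> K" unfolding K_def by linarith
    hence "\<pi> ^ K = \<pi> ^ b * \<pi> ^ (K - b)" by (simp flip: power_add)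
    moreover have "of_int (int p ^ (K - b)) = \<pi> ^ (K - b)" by (simp add: \<pi>_def)
    ultimately have "c n / \<pi> ^ b = of_int (int p ^ (K - b)) * (c n / \<pi> ^ K)"
      using \<pi> by simp
    thus ?thesis
      using c_div[of n] by (simp only: K_def padic_alg_ints_mult of_int_in_padic_alg_ints)
  qed
  have P_nat: "(poly P (of_nat x) - F x) / \<pi> ^ b \<in> padic_alg_ints" for x
  proof -
    \<comment> \<open>Terms with \<open>n > x\<close> vanish, so summing up to \<open>N\<close>
      makes the whole of \<open>P\<close> appear even when \<open>x < d\<close>.\<close>
    define N where "N = max x d"
    have "F x = (\<Sum>n\<le>x. of_nat (x choose n) * c n)"
      unfolding c_def by (rule umbral_newton)
    also have "\<dots> = (\<Sum>n\<le>N. of_nat (x choose n) * c n)"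
      by (rule sum.mono_neutral_left) (auto simp: N_def)
    also have "{..N} = {0..d} \<union> {d<..N}"
      by (auto simp: N_def)
    also have "(\<Sum>n\<in>\<dots>. of_nat (x choose n) * c n) =
        (\<Sum>n=0..d. of_nat (x choose n) * c n) + (\<Sum>n\<in>{d<..N}. of_nat (x choose n) * c n)"
      by (rule sum.union_disjoint) auto
    also have "(\<Sum>n=0..d. of_nat (x choose n) * c n) = poly P (of_nat x)"
      by (simp add: P_def poly_sum poly_binom_poly binomial_gbinomial mult.commute)
    finally have "(poly P (of_nat x) - F x) / \<pi> ^ b =
        - (\<Sum>n\<in>{d<..N}. of_int (int (x choose n)) * (c n / \<pi> ^ b))"
      by (simp add: sum_divide_distrib)
    also have "\<dots> \<in> padic_alg_ints"
      using c_large
      by (intro padic_alg_ints_uminus padic_alg_ints_sum padic_alg_ints_mult of_int_in_padic_alg_ints) auto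
    finally show ?thesis .
  qed
  have "padic_cong b (poly P (of_int (int p ^ a * m + r))) (poly f (of_int m) * g r)"
    if r: "r \<in> {0..int p ^ a - 1}" for m r
  proof -
    define s where "s = nat r"
    have "int s < int p ^ a" using r by (simp add: s_def)
    hence s: "s < q" unfolding q_def by (metis of_nat_less_iff of_nat_power)
    have r_eq: "r = int s" using r by (simp add: s_def)
    \<comment> \<open>For a fixed residue \<open>s\<close> the scaled error is a polynomial in the
      quotient. \<open>P_nat\<close> makes it integral at naturals, and so it is integral at
      negative \<open>m\<close> as well.\<close>
    define H where "H = smult (inverse (\<pi> ^ b))
      (pcompose P [:of_nat s, of_nat q:] - smult (g r) f)"
    have H: "poly H z = (poly P (of_nat s + z * of_nat q) - g r * poly f z) / \<pi> ^ b" for z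
      by (simp add: H_def poly_pcompose divide_inverse mult.commute)
    have "poly H (of_nat k) \<in> padic_alg_ints" for k
    proof -
      have "F (s + k * q) = g r * poly f (of_nat k)"
        using s by (simp add: F_def r_eq)
      thus ?thesis
        using P_nat[of "s + k * q"] by (simp add: H)
    qed
    hence "poly H (of_int m) \<in> padic_alg_ints"
      by (rule poly_of_int_in_padic_alg_ints)
    moreover have "of_nat s + of_int m * of_nat q =
        (of_int (int p ^ a * m + r) :: 'p padic_closure)"
      by (simp add: r_eq q_def algebra_simps)
    ultimately show ?thesis
      by (simp only: H padic_cong_def \<pi>_def assms(1) mult.commute[of "g r"])
  qed
  thus ?thesis
    using c_int ord by (intro exI[of _ P] exI[of _ c]) (auto simp: P_def)
qed

end
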